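(* Let $k \ge 11$ and let $R$ be a rainbow clique on $k$ vertices. Then $R$ is a fractalizer, and \[ \operatorname{ind}(R) = \frac{k!}{k^k-k}. \]
   Context: An edge-coloring of a complete graph $G$ is a function $\chi: E(G) \to T$ for a set $T$ of colors; $G$ is then $T$-colored. A colored complete graph is rainbow if its coloring is injective. Two colored complete graphs $G, H$ are isomorphic if there is a bijection $V(G)\to V(H)$ preserving the colors of all edges. For a $T$-colored complete graph $F$ on $k$ vertices and a $T$-colored complete graph $G$ on $n>k$ vertices, let $I(F,G)$ be the number of $k$-subsets $S\subseteq V(G)$ with $G[S]\cong F$ (as colored graphs), and $\varrho(F,G) = I(F,G)/\binom{n}{k}$. Let $I(F,n)$ be the maximum of $I(F,G)$ over all $T$-colored complete graphs $G$ on $n$ vertices, $\operatorname{ind}(F,n) = I(F,n)/\binom nk$ (a non-increasing sequence in $n$), and the inducibility $\operatorname{ind}(F) = \lim_{n\to\infty}\operatorname{ind}(F,n)$. Iterated balanced blow-up: label $V(F)=[k]$. Define families $\mathcal{G}_F(n)$ of $T$-colored complete graphs on $n$ vertices inductively: for $n<k$, $\mathcal{G}_F(n)$ consists of a $T$-colored complete graph on $n$ vertices (it contains no $k$-subsets, so its coloring is irrelevant); for $n \ge k$, $G \in \mathcal{G}_F(n)$ if there is a partition $V(G) = V_1\cup\cdots\cup V_k$ with $||V_i|-|V_j||\le 1$ for all $i,j$, $G[V_i]\in\mathcal{G}_F(|V_i|)$ for all $i$, and for $v\in V_i$, $w\in V_j$, $i\ne j$, the color of $vw$ in $G$ equals the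 color of $ij$ in $F$. $F$ is a fractalizer if $\operatorname{ind}(F) = \lim_{n\to\infty}\max_{G\in\mathcal{G}_F(n)}\varrho(F,G)$. *)

theory Defs
  imports Complex_Main "HOL-Library.Ramsey" "HOL-Library.Disjoint_Sets"
begin

text \<open>Edges are two-element vertex sets; the values of \<open>color\<close> on all other sets are irrelevant.\<close>

record ('v, 't) cgraph =
  verts :: "'v set"
  color :: "'v set \<Rightarrow> 't"

definition edges :: "('v, 't) cgraph \<Rightarrow> 'v set set" where
  "edges G = nsets (verts G) 2"

definition num_verts :: "('v, 't) cgraph \<Rightarrow> nat" where
  "num_verts G = card (verts G)"

definition colored_complete :: "'t set \<Rightarrow> ('v, 't) cgraph \<Rightarrow> bool" where
  "colored_complete T G \<longleftrightarrow> finite (verts G) \<and> (\<forall>e\<in>edges G. color G e \<in> T)"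

definition rainbow :: "('v, 't) cgraph \<Rightarrow> bool" where
  "rainbow G \<longleftrightarrow> inj_on (color G) (edges G)"

definition cgraph_iso :: "('v, 't) cgraph \<Rightarrow> ('w, 't) cgraph \<Rightarrow> bool" where
  "cgraph_iso G H \<longleftrightarrow>
     (\<exists>f. bij_betw f (verts G) (verts H) \<and> (\<forall>e\<in>edges G. color H (f ` e) = color G e))"

definition induced :: "('v, 't) cgraph \<Rightarrow> 'v set \<Rightarrow> ('v, 't) cgraph" where
  "induced G S = \<lparr>verts = S, color = color G\<rparr>"

definition copies :: "('a, 't) cgraph \<Rightarrow> ('v, 't) cgraph \<Rightarrow> nat" where
  "copies F G = card {S \<in> nsets (verts G) (num_verts F). cgraph_iso (induced G S) F}"

definition copy_density :: "('a, 't) cgraph \<Rightarrow> ('v, 't) cgraph \<Rightarrow> real" where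
  "copy_density F G = real (copies F G) / real (num_verts G choose num_verts F)"

text \<open>Every finite graph is isomorphic to one whose vertices are natural numbers, so host graphs are
  taken with vertices in \<open>nat\<close>. The numbers of copies are at most \<open>n choose num_verts F\<close>, so the maximum
  is over a finite set even if \<open>T\<close> is infinite.\<close>

definition max_copies :: "'t set \<Rightarrow> ('a, 't) cgraph \<Rightarrow> nat \<Rightarrow> nat" where
  "max_copies T F n =
     Max {copies F G |G :: (nat, 't) cgraph. colored_complete T G \<and> num_verts G = n}"

definition ind_n :: "'t set \<Rightarrow> ('a, 't) cgraph \<Rightarrow> nat \<Rightarrow> real" where
  "ind_n T F n = real (max_copies T F n) / real (n choose num_verts F)"

definition inducibility :: "'t set \<Rightarrow> ('a, 't) cgraph \<Rightarrow> real" where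
  "inducibility T F = lim (ind_n T F)"

text \<open>The parts of the blow-up are indexed by the vertices of \<open>F\<close> themselves instead of by a labelling
  of them. Below \<open>num_verts F\<close> vertices, every \<open>T\<close>-coloring is admitted. The inductive definition is the
  recursion on the number of vertices whenever \<open>num_verts F \<ge> 2\<close>, as all parts are then
  strictly smaller than the whole.\<close>

inductive iterated_blowup :: "'t set \<Rightarrow> ('a, 't) cgraph \<Rightarrow> ('v, 't) cgraph \<Rightarrow> bool"
  for T :: "'t set" and F :: "('a, 't) cgraph"
where
  small: "\<lbrakk>colored_complete T G; num_verts G < num_verts F\<rbrakk> \<Longrightarrow> iterated_blowup T F G"
| blowup: "\<lbrakk>colored_complete T G; num_verts F \<le> num_verts G;
     verts G = (\<Union>i\<in>verts F. V i); disjoint_family_on V (verts F);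
     \<forall>i\<in>verts F. \<forall>j\<in>verts F. \<bar>int (card (V i)) - int (card (V j))\<bar> \<le> 1;
     \<forall>i\<in>verts F. iterated_blowup T F (induced G (V i));
     \<forall>i\<in>verts F. \<forall>j\<in>verts F. i \<noteq> j \<longrightarrow>
       (\<forall>v\<in>V i. \<forall>w\<in>V j. color G {v, w} = color F {i, j})\<rbrakk> \<Longrightarrow> iterated_blowup T F G"

text \<open>The limit is stated as convergence, because an equation between two values of \<open>lim\<close> would
  also hold if neither sequence converged.\<close>

definition fractalizer :: "'t set \<Rightarrow> ('a, 't) cgraph \<Rightarrow> bool" where
  "fractalizer T F \<longleftrightarrow>
     (\<lambda>n. Max {copy_density F G |G :: (nat, 't) cgraph. iterated_blowup T F G \<and> num_verts G = n})
       \<longlonglongrightarrow> inducibility T F"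

end

theory Submission
  imports Defs "HOL-Analysis.Convex"
begin

text \<open>Upper bound: a coloring of \<open>n\<close> vertices has at most \<open>n ^ k / (k ^ k - k)\<close> copies. In a minimal
  counterexample every vertex lies in more than \<open>((n - 1) / k) ^ (k - 1)\<close> copies. The copies in which
  \<open>v\<close> plays the role \<open>a\<close> number at most the product over \<open>b\<close> of the degrees of \<open>v\<close> in the color of \<open>ab\<close>,
  so AM-GM gives \<open>v\<close> a dominant role \<open>i\<close>: at most \<open>2 (n - 1) / k\<close> edges at \<open>v\<close> have a color of an edge of
  \<open>R\<close> that avoids \<open>i\<close>. Partition the vertices by dominant role. A copy without an edge between
  different parts whose color is wrong is either a transversal or inside one part. A wrong edge
  forces one of its ends into a non-dominant role, so it is in very few copies, fewer than the
  transversals that it destroys even after division by \<open>k choose 2\<close>. Hence the copies number at most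
  the product of the part sizes plus the copies inside the parts, and the induction closes by
  \<open>(k ^ k - k) p\<^sub>1 \<dots> p\<^sub>k + \<Sum> p\<^sub>i ^ k \<le> (\<Sum> p\<^sub>i) ^ k\<close>, which is AM-GM applied to the monomials of the
  right-hand side.

  Lower bound: iterated balanced blow-ups have at least \<open>n ^ k / (k ^ k - k) - n ^ (k - 1)\<close> copies.\<close>

section \<open>Inequalities\<close>

lemma prod_le_mean_power:
  fixes x :: "'a \<Rightarrow> real"
  assumes "finite S" and nonneg: "\<And>i. i \<in> S \<Longrightarrow> 0 \<le> x i"
  shows "(\<Prod>i\<in>S. x i) \<le> ((\<Sum>i\<in>S. x i) / card S) ^ card S"
proof (cases "S = {}")
  case False
  have pos: "card S > 0" using assms False by (simp add: card_gt_0_iff)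
  have P: "0 \<le> (\<Prod>i\<in>S. x i)" using nonneg by (simp add: prod_nonneg)
  have "(\<Prod>i\<in>S. x i) powr (1 / card S) \<le> (\<Sum>i\<in>S. x i) / card S"
    using arith_geom_mean[OF \<open>finite S\<close> False nonneg] by (simp add: sum_divide_distrib)
  then have "((\<Prod>i\<in>S. x i) powr (1 / card S)) ^ card S \<le> ((\<Sum>i\<in>S. x i) / card S) ^ card S"
    by (intro power_mono) auto
  moreover have "((\<Prod>i\<in>S. x i) powr (1 / card S)) ^ card S = (\<Prod>i\<in>S. x i)"
    using pos P by (cases "(\<Prod>i\<in>S. x i) = 0") (simp_all add: powr_realpow[symmetric] powr_powr)
  ultimately show ?thesis by simp
qed simp

lemma prod_shift_mod:
  fixes y :: "nat \<Rightarrow> real"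
  assumes "k > 0"
  shows "(\<Prod>s<k. y ((m + s) mod k)) = (\<Prod>j<k. y j)"
proof -
  have "j \<in> (\<lambda>s. (m + s) mod k) ` {..<k}" if "j < k" for j
  proof
    have "m mod k < k" using assms by simp
    \<comment> \<open>The preimage of \<open>j\<close> is \<open>j - m\<close> modulo
      \<open>k\<close>; adding \<open>k - m mod k\<close> instead avoids truncated
      subtraction.\<close>
    then have "m + (j + (k - m mod k)) = j + (k + k * (m div k))"
      using mult_div_mod_eq[of k m] by linarith
    then have shift: "(m + (j + (k - m mod k))) mod k = (j + (k + k * (m div k))) mod k" by (rule arg_cong)
    have "(m + (j + (k - m mod k)) mod k) mod k = (j + (k + k * (m div k))) mod k"
      using shift by (simp only: mod_add_right_eq)
    also have "\<dots> = j" using that by (metis add.assoc mod_add_self2 mod_less mod_mult_self2)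
    finally show "j = (m + (j + (k - m mod k)) mod k) mod k" ..
    show "(j + (k - m mod k)) mod k \<in> {..<k}" using assms by simp
  qed
  then have img: "(\<lambda>s. (m + s) mod k) ` {..<k} = {..<k}" using assms by auto
  then have inj: "inj_on (\<lambda>s. (m + s) mod k) {..<k}" by (intro eq_card_imp_inj_on) auto
  show ?thesis
    using prod.reindex[OF inj, of y] img by simp
qed

text \<open>Expanding the right-hand side gives one monomial \<open>w f\<close> for each self-map
  \<open>f\<close> of \<open>{..<k}\<close>. The \<open>k\<close> constant maps contribute the
  powers \<open>y j ^ k\<close>. Adding a constant modulo \<open>k\<close> to all values permutes
  the other \<open>k ^ k - k\<close> maps, and AM-GM over the \<open>k\<close> shifts of one map
  bounds their average monomial from below by the product of all \<open>y j\<close>.\<close>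

lemma prod_plus_sum_powers_le_nat:
  fixes y :: "nat \<Rightarrow> real"
  assumes k: "k > 0" and nonneg: "\<And>j. 0 \<le> y j"
  shows "(real k ^ k - real k) * (\<Prod>j<k. y j) + (\<Sum>j<k. y j ^ k) \<le> (\<Sum>j<k. y j) ^ k"
proof -
  define F where "F = {..<k} \<rightarrow>\<^sub>E {..<k}"
  define C where "C = (\<lambda>j. restrict (\<lambda>_. j) {..<k}) ` {..<k}"
  define w where "w f = (\<Prod>a<k. y (f a))" for f :: "nat \<Rightarrow> nat"
  define sh where "sh s f = restrict (\<lambda>a. (f a + s) mod k) {..<k}" for s and f :: "nat \<Rightarrow> nat"
  have finF: "finite F" by (simp add: F_def finite_PiE)
  have CF: "C \<subseteq> F" by (auto simp: C_def F_def PiE_def extensional_def)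
  have injC: "inj_on (\<lambda>j. restrict (\<lambda>_. j) {..<k}) {..<k}"
    using k by (intro inj_onI) (metis lessThan_iff restrict_apply')
  have cardC: "card C = k" by (simp add: C_def card_image[OF injC])
  have cardF: "card F = k ^ k" by (simp add: F_def card_PiE)
  have "k ^ 1 \<le> k ^ k" using k by (intro power_increasing) auto
  then have card: "real (card (F - C)) = real k ^ k - real k"
    using CF finF by (simp add: card_Diff_subset finite_subset cardC cardF of_nat_diff)
  have "(\<Sum>j<k. y j) ^ k = (\<Prod>a<k. \<Sum>j<k. y j)" by simp
  also have "\<dots> = sum w F"
    by (subst prod_sum_PiE) (auto simp: F_def w_def)
  also have "\<dots> = sum w C + sum w (F - C)"
    using CF finF by (metis add.commute sum.subset_diff)
  also have "sum w C = (\<Sum>j<k. y j ^ k)"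
    unfolding C_def by (subst sum.reindex[OF injC]) (simp add: w_def)
  finally have split: "(\<Sum>j<k. y j) ^ k = (\<Sum>j<k. y j ^ k) + sum w (F - C)" .
  \<comment> \<open>Shifting by \<open>k - s\<close> undoes shifting by \<open>s\<close>, and both
    keep constant maps constant, so \<open>sh s\<close> permutes \<open>F - C\<close>.\<close>
  have shift: "sum w (F - C) = (\<Sum>f\<in>F - C. w (sh s f))" if "s < k" for s
  proof -
    have maps: "sh r f \<in> F" if "f \<in> F" for r f using k that by (auto simp: sh_def F_def)
    have inv: "sh (k - r) (sh r f) = f \<and> sh r (sh (k - r) f) = f" if "f \<in> F" "r < k" for r f
    proof -
      have *: "((x + r) mod k + (k - r)) mod k = x \<and> ((x + (k - r)) mod k + r) mod k = x"
        if "x < k" for x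
      proof -
        have "((x + r) mod k + (k - r)) mod k = (x + r + (k - r)) mod k" by (rule mod_add_left_eq)
        moreover have "((x + (k - r)) mod k + r) mod k = (x + (k - r) + r) mod k" by (rule mod_add_left_eq)
        ultimately show ?thesis using that \<open>r < k\<close> by simp
      qed
      have "f a < k" if "a < k" for a using \<open>f \<in> F\<close> that by (auto simp: F_def)
      then show ?thesis using \<open>f \<in> F\<close> *
        by (auto simp: sh_def F_def fun_eq_iff PiE_def extensional_def restrict_def)
    qed
    have C: "sh r f \<in> C" if "f \<in> C" for r f
      using that k by (auto simp: C_def sh_def image_iff fun_eq_iff intro!: bexI[of _ "(_ + r) mod k"])
    show ?thesis
    proof (rule sum.reindex_bij_witness[where i = "sh s" and j = "sh (k - s)"])
      fix f assume f: "f \<in> F - C"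
      show "sh s (sh (k - s) f) = f" using inv f that by auto
      show "sh (k - s) f \<in> F - C" using maps C inv f that by (metis DiffE DiffI)
      show "sh (k - s) (sh s f) = f" using inv f that by auto
      show "sh s f \<in> F - C" using maps C inv f that by (metis DiffE DiffI)
      show "w (sh s (sh (k - s) f)) = w f" using inv f that by auto
    qed
  qed
  have each: "real k * (\<Prod>j<k. y j) \<le> (\<Sum>s<k. w (sh s f))" for f
  proof -
    have nn: "0 \<le> w g" for g using nonneg by (simp add: w_def prod_nonneg)
    \<comment> \<open>For each \<open>a\<close>, the value \<open>(f a + s) mod k\<close> runs
      through all of \<open>{..<k}\<close> as \<open>s\<close> varies, so this product is the same
      for every \<open>f\<close>.\<close>
    have "(\<Prod>s<k. w (sh s f)) = (\<Prod>a<k. \<Prod>s<k. y ((f a + s) mod k))"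
      by (subst prod.swap) (simp add: w_def sh_def)
    also have "\<dots> = (\<Prod>j<k. y j) ^ k" using k by (simp add: prod_shift_mod)
    finally have "(\<Prod>j<k. y j) ^ k \<le> ((\<Sum>s<k. w (sh s f)) / k) ^ k"
      using prod_le_mean_power[of "{..<k}" "\<lambda>s. w (sh s f)"] nn by simp
    then have "(\<Prod>j<k. y j) \<le> (\<Sum>s<k. w (sh s f)) / k"
      using k nn by (subst (asm) power_mono_iff) (auto intro!: prod_nonneg nonneg sum_nonneg divide_nonneg_nonneg)
    then show ?thesis using k by (simp add: field_simps)
  qed
  have "real k * sum w (F - C) = (\<Sum>s<k. sum w (F - C))" by simp
  also have "\<dots> = (\<Sum>s<k. \<Sum>f\<in>F - C. w (sh s f))" using shift by simp
  also have "\<dots> = (\<Sum>f\<in>F - C. \<Sum>s<k. w (sh s f))" by (rule sum.swap)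
  also have "\<dots> \<ge> (\<Sum>f\<in>F - C. real k * (\<Prod>j<k. y j))" by (rule sum_mono) (rule each)
  finally have "real k * ((real k ^ k - real k) * (\<Prod>j<k. y j)) \<le> real k * sum w (F - C)"
    by (simp add: card algebra_simps)
  then have "(real k ^ k - real k) * (\<Prod>j<k. y j) \<le> sum w (F - C)" using k by simp
  with split show ?thesis by simp
qed

lemma prod_plus_sum_powers_le:
  fixes p :: "'a \<Rightarrow> real"
  assumes "finite K" "K \<noteq> {}" and nonneg: "\<And>i. i \<in> K \<Longrightarrow> 0 \<le> p i"
  shows "(real (card K) ^ card K - real (card K)) * (\<Prod>i\<in>K. p i) + (\<Sum>i\<in>K. p i ^ card K)
    \<le> (\<Sum>i\<in>K. p i) ^ card K"
proof -
  obtain h where h: "bij_betw h {..<card K} K"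
    using ex_bij_betw_nat_finite[OF \<open>finite K\<close>] by (auto simp: lessThan_atLeast0)
  have "card K > 0" using assms by (simp add: card_gt_0_iff)
  have *: "h j \<in> K" if "j < card K" for j using h that by (auto simp: bij_betw_def)
  \<comment> \<open>The default 0 meets the nonnegativity condition of the version on
    \<open>nat\<close>, which concerns every index.\<close>
  define y where "y j = (if j < card K then p (h j) else 0)" for j
  have "(\<Prod>i\<in>K. p i) = (\<Prod>j<card K. y j)" "(\<Sum>i\<in>K. p i) = (\<Sum>j<card K. y j)"
    "(\<Sum>i\<in>K. p i ^ card K) = (\<Sum>j<card K. y j ^ card K)"
    by (simp_all add: y_def prod.reindex_bij_betw[OF h, symmetric] sum.reindex_bij_betw[OF h, symmetric])
  then show ?thesis
    using prod_plus_sum_powers_le_nat[of "card K" y] \<open>card K > 0\<close> * nonneg by (simp add: y_def)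
qed

section \<open>Numerical estimates in \<open>k\<close>\<close>

lemma Bernoulli_second_order:
  fixes x :: real
  assumes "x \<ge> 0"
  shows "1 + real m * x + real m * (real m - 1) / 2 * x\<^sup>2 \<le> (1 + x) ^ m"
proof (induction m)
  case (Suc m)
  have "0 \<le> real m * (real m - 1)" by (cases m) auto
  then have "0 \<le> real m * (real m - 1) / 2 * x ^ 3" using assms by simp
  then have "1 + real (Suc m) * x + real (Suc m) * (real (Suc m) - 1) / 2 * x\<^sup>2
    \<le> (1 + real m * x + real m * (real m - 1) / 2 * x\<^sup>2) * (1 + x)"
    by (simp add: field_simps power2_eq_square power3_eq_cube)
  also have "\<dots> \<le> (1 + x) ^ m * (1 + x)" using Suc assms by (intro mult_right_mono) auto
  finally show ?case by (simp add: mult.commute)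
qed simp

text \<open>With \<open>q = k - 2\<close> and after division by \<open>q ^ q * (q + 1)\<close>, the
  claim reads \<open>2 + 2 / (q + 1) < (1 + 1 / q) ^ q\<close>. The first-order Bernoulli inequality
  yields only 2; the quadratic term adds \<open>(q - 1) / (2 * q)\<close>, which suffices.\<close>

lemma two_mult_power_less:
  assumes "k \<ge> 11"
  shows "2 * real k * (real k - 2) ^ (k - 2) < (real k - 1) ^ (k - 1)"
proof -
  define q where "q = k - 2"
  have k: "k = q + 2" and q: "q \<ge> 9" using assms by (auto simp: q_def)
  have "9 * real q \<le> real q * real q" using q by (intro mult_right_mono) auto
  \<comment> \<open>This is \<open>2 / (q + 1) < (q - 1) / (2 * q)\<close> with denominators
    cleared.\<close>
  then have quad: "4 * real q < real q * real q - 1" using q by linarith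
  have "1 + real q * (1 / real q) + real q * (real q - 1) / 2 * (1 / real q)\<^sup>2
      = 2 + (real q - 1) / (2 * real q)"
    using q by (simp add: power2_eq_square)
  then have "2 + (real q - 1) / (2 * real q) \<le> (1 + 1 / real q) ^ q"
    using Bernoulli_second_order[of "1 / real q" q] by simp
  then have "real q ^ q * (2 + (real q - 1) / (2 * real q)) \<le> real q ^ q * (1 + 1 / real q) ^ q"
    by (intro mult_left_mono) auto
  also have "\<dots> = (real q + 1) ^ q"
    using q by (simp add: power_mult_distrib[symmetric] field_simps)
  finally have *: "(real q + 1) * (real q ^ q * (2 + (real q - 1) / (2 * real q)))
    \<le> (real q + 1) * (real q + 1) ^ q"
    by (intro mult_left_mono) auto
  have "2 * (real q + 2) < (real q + 1) * (2 + (real q - 1) / (2 * real q))"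
    using quad q by (simp add: field_simps)
  then have "2 * (real q + 2) * real q ^ q
      < (real q + 1) * (2 + (real q - 1) / (2 * real q)) * real q ^ q"
    using q by (intro mult_strict_right_mono) auto
  with * show ?thesis by (simp add: k algebra_simps)
qed

text \<open>This is \<open>pair_bound\<close> for \<open>m = k - 3\<close> with denominators
  cleared. It is false at \<open>m = 7\<close>, that is, at \<open>k = 10\<close>, so among the
  numerical estimates it is the one that dictates \<open>k \<ge> 11\<close>.\<close>

lemma pair_bound_nat:
  fixes m :: nat
  assumes "m \<ge> 8"
  shows "(m + 3) ^ 4 * (m + 2) * 2 ^ m \<le> 3 * m ^ m"
  using assms
proof (induction m rule: dec_induct)
  case (step m)
  \<comment> \<open>Substituting \<open>8 + j\<close> turns the polynomial inequality below into a
    comparison of the coefficients of the powers of \<open>j\<close>.\<close>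
  obtain j where j: "m = 8 + j" using step.hyps(1) le_Suc_ex by blast
  have "2 * (m + 4) ^ 4 * (m + 3) \<le> (m + 1) * ((m + 3) ^ 4 * (m + 2))"
    by (simp add: j algebra_simps power_numeral_reduce)
  then have "2 * (m + 4) ^ 4 * (m + 3) * 2 ^ m \<le> (m + 1) * ((m + 3) ^ 4 * (m + 2)) * 2 ^ m"
    by (rule mult_right_mono) simp
  also have "\<dots> = (m + 1) * ((m + 3) ^ 4 * (m + 2) * 2 ^ m)" by (simp only: mult.assoc)
  also have "\<dots> \<le> (m + 1) * (3 * m ^ m)" by (rule mult_left_mono[OF step.IH]) simp
  also have "\<dots> \<le> (m + 1) * (3 * (m + 1) ^ m)" by (intro mult_left_mono power_mono) auto
  finally have "2 * (m + 4) ^ 4 * (m + 3) * 2 ^ m \<le> (m + 1) * (3 * (m + 1) ^ m)" .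
  moreover have "Suc m + 3 = m + 4" "Suc m + 2 = m + 3" "Suc m = m + 1" by simp_all
  ultimately show ?case by (simp only: power_add power_one_right mult_ac)
qed simp

lemma wrong_role_bound_nat:
  fixes m :: nat
  assumes "m \<ge> 9"
  shows "4 * 2 ^ m * (m + 2)\<^sup>2 \<le> m ^ m"
  using assms
proof (induction m rule: dec_induct)
  case (step m)
  obtain j where j: "m = 9 + j" using step.hyps(1) le_Suc_ex by blast
  have "2 * (m + 3)\<^sup>2 \<le> (m + 1) * (m + 2)\<^sup>2"
    by (simp add: j algebra_simps power_numeral_reduce)
  then have "(4 * 2 ^ m) * (2 * (m + 3)\<^sup>2) \<le> (4 * 2 ^ m) * ((m + 1) * (m + 2)\<^sup>2)"
    by (rule mult_left_mono) simp
  also have "\<dots> = (m + 1) * (4 * 2 ^ m * (m + 2)\<^sup>2)" by (simp only: ac_simps)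
  also have "\<dots> \<le> (m + 1) * m ^ m" by (rule mult_left_mono[OF step.IH]) simp
  also have "\<dots> \<le> (m + 1) * (m + 1) ^ m" by (intro mult_left_mono power_mono) auto
  finally have "4 * 2 ^ m * (2 * (m + 3)\<^sup>2) \<le> (m + 1) * (m + 1) ^ m" .
  moreover have "Suc m + 2 = m + 3" "Suc m = m + 1" by simp_all
  ultimately show ?case by (simp only: power_add power_one_right mult_ac)
qed simp

text \<open>Up to a factor \<open>n ^ (k - 2)\<close>, the left-hand side bounds
  \<open>k choose 2\<close> times the number of copies through a miscolored pair, and the right-hand
  side is a lower bound for the number of transversals through it.\<close>

lemma pair_bound:
  assumes "k \<ge> 11"
  shows "real k * (real k - 1) * (2 / (real k * (real k - 3))) ^ (k - 3) \<le> 3 / real k ^ k"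
proof -
  define m where "m = k - 3"
  have k: "k = m + 3" and m: "m \<ge> 8" using assms by (auto simp: m_def)
  have "real ((m + 3) ^ 4 * (m + 2) * 2 ^ m) \<le> real (3 * m ^ m)"
    using pair_bound_nat[OF m] of_nat_le_iff by blast
  then have "(real m + 3) ^ 4 * (real m + 2) * 2 ^ m \<le> 3 * real m ^ m"
    by (simp only: of_nat_mult of_nat_power of_nat_add of_nat_numeral)
  then have "(real m + 3) * (real m + 2) * 2 ^ m * (real m + 3) ^ 3 \<le> 3 * real m ^ m"
    by (simp add: power_numeral_reduce mult_ac)
  then have "(real m + 3) ^ m * ((real m + 3) * (real m + 2) * 2 ^ m * (real m + 3) ^ 3)
      \<le> (real m + 3) ^ m * (3 * real m ^ m)"
    by (intro mult_left_mono) auto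
  then show ?thesis using m
    by (simp add: k power_divide power_mult_distrib power_add power2_eq_square divide_simps mult_ac add_ac)
qed

text \<open>It makes the copies with a vertex in a non-dominant role, summed over all vertices, at
  most a quarter of \<open>n ^ k / k ^ k\<close>.\<close>

lemma wrong_role_bound:
  assumes "k \<ge> 11"
  shows "(2 / (real k * (real k - 2))) ^ (k - 2) \<le> 1 / (4 * real k ^ k)"
proof -
  define m where "m = k - 2"
  have k: "k = m + 2" and m: "m \<ge> 9" using assms by (auto simp: m_def)
  have "real (4 * 2 ^ m * (m + 2)\<^sup>2) \<le> real (m ^ m)"
    using wrong_role_bound_nat[OF m] of_nat_le_iff by blast
  then have "4 * 2 ^ m * (real m + 2)\<^sup>2 \<le> real m ^ m"
    by (simp only: of_nat_mult of_nat_power of_nat_add of_nat_numeral)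
  then have "(real m + 2) ^ m * (4 * 2 ^ m * (real m + 2)\<^sup>2) \<le> (real m + 2) ^ m * real m ^ m"
    by (intro mult_left_mono) auto
  then show ?thesis using m
    by (simp add: k power_divide power_mult_distrib power_add power2_eq_square divide_simps mult_ac add_ac)
qed

section \<open>Existence of a dominant role\<close>

lemma sum_incident_pairs:
  fixes x :: "'a set \<Rightarrow> real"
  assumes "finite K" "i \<in> K"
  shows "(\<Sum>b\<in>K - {i}. x {i, b}) = (\<Sum>e\<in>{e \<in> nsets K 2. i \<in> e}. x e)"
proof -
  have inj: "inj_on (\<lambda>b. {i, b}) (K - {i})" by (auto simp: inj_on_def doubleton_eq_iff)
  have "{e \<in> nsets K 2. i \<in> e} = (\<lambda>b. {i, b}) ` (K - {i})"
    using assms by (auto simp: nsets_2_eq)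
  then show ?thesis by (simp add: sum.reindex[OF inj])
qed

lemma sum_sum_incident_pairs:
  fixes x :: "'a set \<Rightarrow> real"
  assumes "finite K"
  shows "(\<Sum>a\<in>K. \<Sum>b\<in>K - {a}. x {a, b}) = 2 * (\<Sum>e\<in>nsets K 2. x e)"
proof -
  have fin: "finite (nsets K 2)" using assms by (simp add: finite_imp_finite_nsets)
  have "(\<Sum>a\<in>K. \<Sum>b\<in>K - {a}. x {a, b}) = (\<Sum>a\<in>K. \<Sum>e\<in>{e \<in> nsets K 2. a \<in> e}. x e)"
    using assms by (intro sum.cong refl sum_incident_pairs)
  also have "\<dots> = (\<Sum>e\<in>nsets K 2. \<Sum>a\<in>{a \<in> K. a \<in> e}. x e)"
    by (rule sum.swap_restrict[OF assms fin])
  also have "\<dots> = (\<Sum>e\<in>nsets K 2. 2 * x e)"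
  proof (intro sum.cong refl)
    fix e assume e: "e \<in> nsets K 2"
    then have "{a \<in> K. a \<in> e} = e" by (auto simp: nsets_def)
    with e show "(\<Sum>a\<in>{a \<in> K. a \<in> e}. x e) = 2 * x e" by (simp add: nsets_def)
  qed
  finally show ?thesis by (simp add: sum_distrib_left)
qed

text \<open>In the application, \<open>x e\<close> is the number of edges at a fixed vertex in the
  color of \<open>e\<close>. The role \<open>i\<close> is chosen to maximize the sum
  \<open>s i\<close> of \<open>x\<close> over the pairs at \<open>i\<close>. AM-GM turns
  \<open>large\<close> into \<open>s i \<ge> N * (1 - 2 / k)\<close>, and the pairs that avoid
  \<open>i\<close> share what remains of \<open>N\<close>.\<close>

lemma ex_dominant_role:
  fixes x :: "'a set \<Rightarrow> real"
  assumes fin: "finite K" and k: "card K = k" "k \<ge> 11" and nonneg: "\<And>e. 0 \<le> x e"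
    and N: "N > 0" and total: "(\<Sum>e\<in>nsets K 2. x e) \<le> N"
    and large: "(N / real k) ^ (k - 1) \<le> (\<Sum>a\<in>K. \<Prod>b\<in>K - {a}. x {a, b})"
  shows "\<exists>i\<in>K. (\<Sum>e\<in>{e \<in> nsets K 2. i \<notin> e}. x e) \<le> 2 * N / real k"
proof -
  define s where "s a = (\<Sum>b\<in>K - {a}. x {a, b})" for a
  have s0: "0 \<le> s a" for a using nonneg by (simp add: s_def sum_nonneg)
  have "K \<noteq> {}" using k by auto
  then obtain i where i: "i \<in> K" and max: "\<And>a. a \<in> K \<Longrightarrow> s a \<le> s i"
    using obtains_MAX[OF fin, of s] fin by (metis Max_ge finite_imageI imageI)
  have k1: "k - 1 = Suc (k - 2)" using k by simp
  have "(\<Sum>a\<in>K. \<Prod>b\<in>K - {a}. x {a, b}) \<le> (\<Sum>a\<in>K. s a * s i ^ (k - 2) / (real k - 1) ^ (k - 1))"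
  proof (rule sum_mono)
    fix a assume a: "a \<in> K"
    have "(\<Prod>b\<in>K - {a}. x {a, b}) \<le> (s a / (real k - 1)) ^ (k - 1)"
      using prod_le_mean_power[of "K - {a}" "\<lambda>b. x {a, b}"] fin a k nonneg
      by (simp add: s_def of_nat_diff)
    \<comment> \<open>One factor \<open>s a\<close> is kept, because the sum of all
      \<open>s a\<close> is at most \<open>2 * N\<close>; the other \<open>k - 2\<close> factors are
      replaced by the maximum \<open>s i\<close>.\<close>
    also have "\<dots> = s a * s a ^ (k - 2) / (real k - 1) ^ (k - 1)"
      by (simp only: k1 power_divide power_Suc times_divide_times_eq)
    also have "\<dots> \<le> s a * s i ^ (k - 2) / (real k - 1) ^ (k - 1)"
      using max[OF a] s0 k by (intro divide_right_mono mult_left_mono power_mono) auto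
    finally show "(\<Prod>b\<in>K - {a}. x {a, b}) \<le> s a * s i ^ (k - 2) / (real k - 1) ^ (k - 1)" .
  qed
  also have "\<dots> = (\<Sum>a\<in>K. s a) * s i ^ (k - 2) / (real k - 1) ^ (k - 1)"
    by (simp add: sum_distrib_right sum_divide_distrib)
  also have "\<dots> \<le> 2 * N * s i ^ (k - 2) / (real k - 1) ^ (k - 1)"
    using sum_sum_incident_pairs[OF fin, of x] total s0 k
    by (intro divide_right_mono mult_right_mono) (auto simp: s_def)
  finally have upper: "(N / real k) ^ (k - 1) \<le> 2 * N * s i ^ (k - 2) / (real k - 1) ^ (k - 1)"
    using large by linarith
  have "N * (1 - 2 / real k) \<le> s i"
  proof (rule ccontr)
    assume "\<not> ?thesis"
    then have "s i ^ (k - 2) \<le> (N * (1 - 2 / real k)) ^ (k - 2)" using s0 by (intro power_mono) auto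
    also have "\<dots> = (N / real k) ^ (k - 2) * (real k - 2) ^ (k - 2)"
      using k by (simp add: power_mult_distrib[symmetric] field_simps)
    finally have "2 * N * s i ^ (k - 2) / (real k - 1) ^ (k - 1)
      \<le> 2 * N * ((N / real k) ^ (k - 2) * (real k - 2) ^ (k - 2)) / (real k - 1) ^ (k - 1)"
      using N k by (intro divide_right_mono mult_left_mono) auto
    also have "\<dots> = (N / real k) ^ (k - 1) * (2 * real k * (real k - 2) ^ (k - 2) / (real k - 1) ^ (k - 1))"
    proof -
      have "2 * N * (P * Q) / M = (N / real k * P) * (2 * real k * Q / M)" for P Q M :: real
        using k by simp
      then show ?thesis by (simp only: k1 power_Suc)
    qed
    also have "\<dots> < (N / real k) ^ (k - 1) * 1"
      using two_mult_power_less[OF k(2)] k N by (intro mult_strict_left_mono) auto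
    finally show False using upper by simp
  qed
  moreover have "(\<Sum>e\<in>nsets K 2. x e) = s i + (\<Sum>e\<in>{e \<in> nsets K 2. i \<notin> e}. x e)"
  proof -
    have "nsets K 2 = {e \<in> nsets K 2. i \<in> e} \<union> {e \<in> nsets K 2. i \<notin> e}" by auto
    then have "(\<Sum>e\<in>nsets K 2. x e) = (\<Sum>e\<in>{e \<in> nsets K 2. i \<in> e}. x e) + (\<Sum>e\<in>{e \<in> nsets K 2. i \<notin> e}. x e)"
      using fin by (subst sum.union_disjoint[symmetric]) (auto simp: finite_imp_finite_nsets)
    then show ?thesis using sum_incident_pairs[OF fin i, of x] by (simp add: s_def)
  qed
  ultimately have "(\<Sum>e\<in>{e \<in> nsets K 2. i \<notin> e}. x e) \<le> 2 * N / real k"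
    using total by (simp add: algebra_simps)
  with i show ?thesis by blast
qed

lemma mult_power_scaled: "x * (2 * x / c) ^ m = x ^ Suc m * (2 / c) ^ m" for x c :: real
  by (simp add: power_mult_distrib power_divide)

lemma power_plus_one_ge:
  fixes x :: real
  assumes "x \<ge> 0"
  shows "x ^ Suc m + real (Suc m) * x ^ m \<le> (x + 1) ^ Suc m"
proof (induction m)
  case (Suc m)
  have "x ^ Suc (Suc m) + real (Suc (Suc m)) * x ^ Suc m
      \<le> (x ^ Suc m + real (Suc m) * x ^ m) * (x + 1)"
    using assms by (simp add: algebra_simps)
  also have "\<dots> \<le> (x + 1) ^ Suc m * (x + 1)" using Suc assms by (intro mult_right_mono) auto
  finally show ?case by (simp only: power_Suc mult_ac)
qed simp

section \<open>The upper bound\<close>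

locale rainbow_pattern =
  fixes K :: "'a set" and r :: "'a set \<Rightarrow> 't" and col :: "'v set \<Rightarrow> 't"
  assumes finite_K: "finite K" and card_K: "card K \<ge> 11" and inj_r: "inj_on r (nsets K 2)"
begin

abbreviation k :: nat where "k \<equiv> card K"

text \<open>A copy is recorded together with its roles: \<open>\<phi> a\<close> plays the role
  \<open>a\<close>. The host vertex set is an argument, so that the induction can pass from
  \<open>V\<close> to \<open>V - {v}\<close> and to the parts within one locale context.\<close>

definition Emb :: "'v set \<Rightarrow> ('a \<Rightarrow> 'v) set" where
  "Emb V = {\<phi> \<in> K \<rightarrow>\<^sub>E V. inj_on \<phi> K \<and> (\<forall>e\<in>nsets K 2. col (\<phi> ` e) = r e)}"

definition nb :: "'v set \<Rightarrow> 'v \<Rightarrow> 'a set \<Rightarrow> 'v set" where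
  "nb V v e = {w \<in> V - {v}. col {v, w} = r e}"

definition deg :: "'v set \<Rightarrow> 'v \<Rightarrow> 'a set \<Rightarrow> real" where
  "deg V v e = real (card (nb V v e))"

definition dominant_role :: "'v set \<Rightarrow> 'v \<Rightarrow> 'a \<Rightarrow> bool" where
  "dominant_role V v i \<longleftrightarrow>
     i \<in> K \<and> (\<Sum>e\<in>{e \<in> nsets K 2. i \<notin> e}. deg V v e) \<le> 2 * real (card V - 1) / real k"

lemma EmbD:
  assumes "\<phi> \<in> Emb V"
  shows "a \<in> K \<Longrightarrow> \<phi> a \<in> V" "a \<in> K \<Longrightarrow> b \<in> K \<Longrightarrow> a \<noteq> b \<Longrightarrow> \<phi> a \<noteq> \<phi> b"
    "a \<in> K \<Longrightarrow> b \<in> K \<Longrightarrow> a \<noteq> b \<Longrightarrow> col {\<phi> a, \<phi> b} = r {a, b}"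
proof -
  show "a \<in> K \<Longrightarrow> \<phi> a \<in> V" using assms by (auto simp: Emb_def)
  show "a \<in> K \<Longrightarrow> b \<in> K \<Longrightarrow> a \<noteq> b \<Longrightarrow> \<phi> a \<noteq> \<phi> b"
    using assms by (auto simp: Emb_def inj_on_def)
  assume "a \<in> K" "b \<in> K" "a \<noteq> b"
  then have "{a, b} \<in> nsets K 2" by simp
  then have "col (\<phi> ` {a, b}) = r {a, b}" using assms unfolding Emb_def by blast
  then show "col {\<phi> a, \<phi> b} = r {a, b}" by simp
qed

lemma finite_Emb: "finite V \<Longrightarrow> finite (Emb V)"
  by (rule finite_subset[of _ "K \<rightarrow>\<^sub>E V"]) (auto simp: Emb_def finite_K finite_PiE)

lemma r_eq_iff:
  assumes "a \<in> K" "b \<in> K" "a \<noteq> b" "c \<in> K" "d \<in> K" "c \<noteq> d"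
  shows "r {a, b} = r {c, d} \<longleftrightarrow> {a, b} = {c, d}"
  using inj_on_eq_iff[OF inj_r, of "{a, b}" "{c, d}"] assms by simp

lemma finite_nb: "finite V \<Longrightarrow> finite (nb V v e)"
  by (simp add: nb_def)

lemma deg_nonneg [simp]: "0 \<le> deg V v e"
  by (simp add: deg_def)

text \<open>As \<open>r\<close> is injective, different pairs \<open>e\<close> ask for different
  colors, so the sets \<open>nb V v e\<close> are disjoint subsets of
  \<open>V - {v}\<close>.\<close>

lemma sum_deg_le:
  assumes "finite V" "v \<in> V"
  shows "(\<Sum>e\<in>nsets K 2. deg V v e) \<le> real (card V - 1)"
proof -
  have "(\<Sum>e\<in>nsets K 2. card (nb V v e)) = card (\<Union>e\<in>nsets K 2. nb V v e)"
    using assms finite_K inj_r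
    by (intro card_UN_disjoint[symmetric]) (auto simp: finite_nb finite_imp_finite_nsets nb_def inj_on_def)
  also have "\<dots> \<le> card (V - {v})"
    using assms by (intro card_mono) (auto simp: nb_def)
  also have "\<dots> = card V - 1" using assms by simp
  finally show ?thesis by (simp add: deg_def flip: of_nat_sum)
qed

lemma deg_le:
  assumes "finite V" "v \<in> V"
  shows "deg V v e \<le> real (card V - 1)"
proof -
  have "card (nb V v e) \<le> card (V - {v})" using assms by (intro card_mono) (auto simp: nb_def)
  then show ?thesis using assms by (simp add: deg_def)
qed

text \<open>Such a copy is determined by its values on \<open>K - A\<close>, and the color of the
  edge to \<open>\<psi> a\<close> confines each of these to one neighbourhood of
  \<open>\<psi> a\<close>. The set \<open>A\<close> is a single role or a pair of roles in the
  applications.\<close>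

lemma card_Emb_fixed_le:
  assumes "finite V" "A \<subseteq> K" "a \<in> A"
  shows "real (card {\<phi> \<in> Emb V. \<forall>x\<in>A. \<phi> x = \<psi> x}) \<le> (\<Prod>c\<in>K - A. deg V (\<psi> a) {a, c})"
proof -
  define X where "X = {\<phi> \<in> Emb V. \<forall>x\<in>A. \<phi> x = \<psi> x}"
  have "inj_on (\<lambda>\<phi>. restrict \<phi> (K - A)) X"
  proof (rule inj_onI, rule ext)
    fix \<phi> \<phi>' x assume *: "\<phi> \<in> X" "\<phi>' \<in> X" "restrict \<phi> (K - A) = restrict \<phi>' (K - A)"
    consider "x \<notin> K" | "x \<in> A" | "x \<in> K - A" using assms by auto
    then show "\<phi> x = \<phi>' x"
    proof cases
      case 1 with * show ?thesis by (auto simp: X_def Emb_def PiE_def extensional_def)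
    next
      case 2 with * show ?thesis by (auto simp: X_def)
    next
      case 3 with * show ?thesis by (metis restrict_apply')
    qed
  qed
  moreover have "(\<lambda>\<phi>. restrict \<phi> (K - A)) ` X \<subseteq> (\<Pi>\<^sub>E c\<in>K - A. nb V (\<psi> a) {a, c})"
  proof (clarsimp simp: X_def)
    fix \<phi> c assume \<phi>: "\<phi> \<in> Emb V" "\<forall>x\<in>A. \<phi> x = \<psi> x" and c: "c \<in> K" "c \<notin> A"
    then have "a \<in> K" "a \<noteq> c" "\<psi> a = \<phi> a" using assms by auto
    then show "\<phi> c \<in> nb V (\<psi> a) {a, c}"
      using EmbD[OF \<phi>(1)] c by (auto simp: nb_def)
  qed
  ultimately have "card X \<le> card (\<Pi>\<^sub>E c\<in>K - A. nb V (\<psi> a) {a, c})"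
    using assms finite_K by (intro card_inj_on_le) (auto intro!: finite_PiE finite_nb)
  also have "\<dots> = (\<Prod>c\<in>K - A. card (nb V (\<psi> a) {a, c}))"
    using finite_K by (simp add: card_PiE)
  finally show ?thesis by (simp add: deg_def X_def flip: of_nat_prod)
qed

lemma card_Emb_at_le:
  assumes "finite V" "a \<in> K"
  shows "real (card {\<phi> \<in> Emb V. \<phi> a = v}) \<le> (\<Prod>c\<in>K - {a}. deg V v {a, c})"
  using card_Emb_fixed_le[of V "{a}" a "\<lambda>_. v"] assms by simp

section \<open>Copies with a vertex in a non-dominant role\<close>

lemma dominant_prod_le:
  assumes dom: "dominant_role V v i" and "a \<in> K" "a \<noteq> i" "D \<subseteq> K - {a, i}"
  shows "(\<Prod>c\<in>D. deg V v {a, c}) \<le> (2 * real (card V - 1) / (real k * real (card D))) ^ card D"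
proof -
  have fin: "finite D" using assms finite_K by (meson finite_Diff finite_subset)
  have inj: "inj_on (\<lambda>c. {a, c}) D" by (auto simp: inj_on_def doubleton_eq_iff)
  have "(\<Sum>c\<in>D. deg V v {a, c}) = (\<Sum>e\<in>(\<lambda>c. {a, c}) ` D. deg V v e)"
    by (simp add: sum.reindex[OF inj])
  \<comment> \<open>All pairs \<open>{a, c}\<close> with \<open>c \<in> D\<close> avoid
    \<open>i\<close>, so dominance bounds the sum of their degrees; AM-GM then bounds the
    product.\<close>
  also have "\<dots> \<le> (\<Sum>e\<in>{e \<in> nsets K 2. i \<notin> e}. deg V v e)"
    using assms finite_K by (intro sum_mono2) (auto simp: finite_imp_finite_nsets)
  also have "\<dots> \<le> 2 * real (card V - 1) / real k" using dom by (simp add: dominant_role_def)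
  finally have sum: "(\<Sum>c\<in>D. deg V v {a, c}) \<le> 2 * real (card V - 1) / real k" .
  have "(\<Prod>c\<in>D. deg V v {a, c}) \<le> ((\<Sum>c\<in>D. deg V v {a, c}) / real (card D)) ^ card D"
    using fin by (intro prod_le_mean_power) auto
  also have "\<dots> \<le> (2 * real (card V - 1) / real k / real (card D)) ^ card D"
    using sum by (intro power_mono divide_right_mono) (auto intro!: sum_nonneg divide_nonneg_nonneg)
  finally show ?thesis by simp
qed

text \<open>For a wrong role \<open>a\<close>, dominance controls the degrees in all colors at
  \<open>a\<close> except that of \<open>{a, i}\<close>. This one factor is split off and summed
  over \<open>a\<close>, which costs at most \<open>card V - 1\<close> in total.\<close>

lemma card_wrong_role_le:
  assumes V: "finite V" "v \<in> V" and dom: "dominant_role V v i"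
  shows "real (card {\<phi> \<in> Emb V. \<exists>a\<in>K - {i}. \<phi> a = v})
    \<le> real (card V - 1) * (2 * real (card V - 1) / (real k * (real k - 2))) ^ (k - 2)"
proof -
  define N where "N = real (card V - 1)"
  define B where "B = (2 * N / (real k * (real k - 2))) ^ (k - 2)"
  have i: "i \<in> K" using dom by (simp add: dominant_role_def)
  have "{\<phi> \<in> Emb V. \<exists>a\<in>K - {i}. \<phi> a = v} = (\<Union>a\<in>K - {i}. {\<phi> \<in> Emb V. \<phi> a = v})" by auto
  then have "card {\<phi> \<in> Emb V. \<exists>a\<in>K - {i}. \<phi> a = v} \<le> (\<Sum>a\<in>K - {i}. card {\<phi> \<in> Emb V. \<phi> a = v})"
    using card_UN_le[of "K - {i}"] finite_K by auto
  then have "real (card {\<phi> \<in> Emb V. \<exists>a\<in>K - {i}. \<phi> a = v})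
      \<le> (\<Sum>a\<in>K - {i}. real (card {\<phi> \<in> Emb V. \<phi> a = v}))"
    by (simp flip: of_nat_sum)
  also have "\<dots> \<le> (\<Sum>a\<in>K - {i}. deg V v {i, a} * B)"
  proof (rule sum_mono)
    fix a assume a: "a \<in> K - {i}"
    have D: "card (K - {a, i}) = k - 2" using a i finite_K by (simp add: card_Diff_subset)
    have "real (card {\<phi> \<in> Emb V. \<phi> a = v}) \<le> (\<Prod>c\<in>K - {a}. deg V v {a, c})"
      using card_Emb_at_le V a by auto
    also have "\<dots> = deg V v {a, i} * (\<Prod>c\<in>K - {a} - {i}. deg V v {a, c})"
      using a i finite_K by (intro prod.remove) auto
    also have "K - {a} - {i} = K - {a, i}" by auto
    also have "(\<Prod>c\<in>K - {a, i}. deg V v {a, c}) \<le> B"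
      using dominant_prod_le[OF dom, of a "K - {a, i}"] a card_K by (simp add: B_def D N_def of_nat_diff)
    finally show "real (card {\<phi> \<in> Emb V. \<phi> a = v}) \<le> deg V v {i, a} * B"
      by (simp add: mult_left_mono insert_commute)
  qed
  also have "\<dots> = (\<Sum>a\<in>K - {i}. deg V v {i, a}) * B" by (simp add: sum_distrib_right)
  also have "\<dots> \<le> N * B"
  proof (rule mult_right_mono)
    have "(\<Sum>a\<in>K - {i}. deg V v {i, a}) \<le> (\<Sum>e\<in>nsets K 2. deg V v e)"
      unfolding sum_incident_pairs[OF finite_K i]
      using finite_K by (intro sum_mono2) (auto simp: finite_imp_finite_nsets)
    also have "\<dots> \<le> N" using sum_deg_le[OF V] by (simp add: N_def)
    finally show "(\<Sum>a\<in>K - {i}. deg V v {i, a}) \<le> N" .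
    show "0 \<le> B" using card_K by (auto simp: B_def N_def intro!: zero_le_power divide_nonneg_nonneg)
  qed
  finally show ?thesis by (simp add: N_def B_def)
qed

text \<open>With two vertices fixed, \<open>k - 2\<close> roles remain. One of them is given up to
  the trivial degree bound, so that the other \<open>k - 3\<close> form pairs with \<open>a\<close>
  that avoid \<open>i\<close>.\<close>

lemma card_wrong_role_pair_le:
  assumes V: "finite V" "v \<in> V" and dom: "dominant_role V v i"
    and ab: "a \<in> K" "b \<in> K" "a \<noteq> b" "a \<noteq> i"
  shows "real (card {\<phi> \<in> Emb V. \<phi> a = v \<and> \<phi> b = w})
    \<le> real (card V - 1) * (2 * real (card V - 1) / (real k * (real k - 3))) ^ (k - 3)"
proof -
  have i: "i \<in> K" using dom by (simp add: dominant_role_def)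
  have cab: "card (K - {a, b}) = k - 2" using ab finite_K by (simp add: card_Diff_subset)
  \<comment> \<open>The role given up is \<open>i\<close> itself; if \<open>b = i\<close> is fixed
    already, any remaining role serves.\<close>
  obtain z where z: "z \<in> K - {a, b}" and zi: "i = b \<or> z = i"
  proof (cases "i = b")
    case True
    have "card (K - {a, b}) \<noteq> 0" using cab card_K by linarith
    then have "K - {a, b} \<noteq> {}" by force
    with True that show ?thesis by blast
  qed (use i ab that in auto)
  define D where "D = K - {a, b} - {z}"
  have D: "card D = k - 3" "D \<subseteq> K - {a, i}"
    using z zi cab by (auto simp: D_def)
  have fin: "finite (K - {a, b})" using finite_K by simp
  have "real (card {\<phi> \<in> Emb V. \<phi> a = v \<and> \<phi> b = w}) \<le> (\<Prod>c\<in>K - {a, b}. deg V v {a, c})"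
    using card_Emb_fixed_le[of V "{a, b}" a "\<lambda>x. if x = a then v else w"] V ab by simp
  also have "\<dots> = deg V v {a, z} * (\<Prod>c\<in>D. deg V v {a, c})"
    unfolding D_def using z fin by (intro prod.remove) auto
  also have "\<dots> \<le> real (card V - 1) * (2 * real (card V - 1) / (real k * (real k - 3))) ^ (k - 3)"
    using dominant_prod_le[OF dom ab(1,4) D(2)] deg_le[OF V] D(1) card_K
    by (intro mult_mono) (auto simp: of_nat_diff intro!: prod_nonneg)
  finally show ?thesis .
qed

text \<open>In a copy through \<open>e\<close>, the two ends play roles \<open>a\<close> and
  \<open>b\<close> with \<open>r {a, b} = col e\<close>. As this is not the color of the pair of
  dominant roles, at least one end is in a wrong role. Injectivity of \<open>r\<close> leaves a
  single pair \<open>{a, b}\<close>; its two orders account for the factor 2.\<close>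

lemma card_miscolored_pair_le:
  assumes V: "finite V" and dom: "\<And>v. v \<in> V \<Longrightarrow> dominant_role V v (\<rho> v)"
    and e: "e \<in> nsets V 2" "inj_on \<rho> e" "col e \<noteq> r (\<rho> ` e)"
  shows "real (card {\<phi> \<in> Emb V. e \<subseteq> \<phi> ` K})
    \<le> 2 * (real (card V - 1) * (2 * real (card V - 1) / (real k * (real k - 3))) ^ (k - 3))"
proof -
  define \<beta> where "\<beta> = real (card V - 1) * (2 * real (card V - 1) / (real k * (real k - 3))) ^ (k - 3)"
  have \<beta>0: "0 \<le> \<beta>" using card_K by (auto simp: \<beta>_def intro!: mult_nonneg_nonneg zero_le_power divide_nonneg_nonneg)
  obtain v w where vw: "e = {v, w}" "v \<in> V" "w \<in> V" "v \<noteq> w"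
    using e(1) by (auto simp: nsets_2_eq)
  define X where "X a b = {\<phi> \<in> Emb V. \<phi> a = v \<and> \<phi> b = w}" for a b
  have X: "real (card (X a b)) \<le> \<beta>"
    if ab: "a \<in> K" "b \<in> K" "a \<noteq> b" "col e = r {a, b}" for a b
  proof (cases "a = \<rho> v")
    case False
    then show ?thesis unfolding X_def \<beta>_def
      using card_wrong_role_pair_le[OF V vw(2) dom[OF vw(2)] ab(1-3)] by simp
  next
    case True
    have "b \<noteq> \<rho> w" using True ab e(3) vw(1) by auto
    moreover have "X a b = {\<phi> \<in> Emb V. \<phi> b = w \<and> \<phi> a = v}" by (auto simp: X_def)
    ultimately show ?thesis unfolding \<beta>_def
      using card_wrong_role_pair_le[OF V vw(3) dom[OF vw(3)] ab(2,1)] ab(3) by simp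
  qed
  have occ: "\<exists>a\<in>K. \<exists>b\<in>K. a \<noteq> b \<and> \<phi> \<in> X a b \<and> col e = r {a, b}"
    if "\<phi> \<in> Emb V" "e \<subseteq> \<phi> ` K" for \<phi>
  proof -
    have "v \<in> \<phi> ` K" "w \<in> \<phi> ` K" using that(2) vw(1) by auto
    then obtain a b where ab: "a \<in> K" "b \<in> K" "v = \<phi> a" "w = \<phi> b" by blast
    then have "a \<noteq> b" using vw(4) by auto
    moreover from this have "col e = r {a, b}" using EmbD(3)[OF that(1) ab(1,2)] ab vw(1) by simp
    moreover have "\<phi> \<in> X a b" using ab that(1) by (simp add: X_def)
    ultimately show ?thesis using ab(1,2) by blast
  qed
  show ?thesis
  proof (cases "{\<phi> \<in> Emb V. e \<subseteq> \<phi> ` K} = {}")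
    case True
    then show ?thesis using \<beta>0 by (simp only: \<beta>_def) simp
  next
    case False
    then obtain a b where ab: "a \<in> K" "b \<in> K" "a \<noteq> b" "col e = r {a, b}" using occ by blast
    have "{\<phi> \<in> Emb V. e \<subseteq> \<phi> ` K} \<subseteq> X a b \<union> X b a"
    proof
      fix \<phi> assume "\<phi> \<in> {\<phi> \<in> Emb V. e \<subseteq> \<phi> ` K}"
      then obtain a' b' where "a' \<in> K" "b' \<in> K" "a' \<noteq> b'" "\<phi> \<in> X a' b'" "col e = r {a', b'}"
        using occ by blast
      moreover from this have "{a', b'} = {a, b}" using r_eq_iff ab by metis
      ultimately show "\<phi> \<in> X a b \<union> X b a" by (auto simp: doubleton_eq_iff)
    qed
    then have "card {\<phi> \<in> Emb V. e \<subseteq> \<phi> ` K} \<le> card (X a b) + card (X b a)"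
      using finite_Emb[OF V] by (intro order_trans[OF card_mono card_Un_le]) (auto simp: X_def)
    moreover have "real (card (X a b)) \<le> \<beta>" "real (card (X b a)) \<le> \<beta>"
      using X ab by (auto simp: insert_commute)
    ultimately show ?thesis unfolding \<beta>_def[symmetric] by linarith
  qed
qed

text \<open>If all edges of a copy between different parts are colored like the pattern, then the map that
  sends each vertex of the pattern to its part fixes every pair that it does not collapse.\<close>

lemma const_or_id:
  assumes maps: "\<And>a. a \<in> K \<Longrightarrow> \<sigma> a \<in> K"
    and pres: "\<And>a b. a \<in> K \<Longrightarrow> b \<in> K \<Longrightarrow> \<sigma> a \<noteq> \<sigma> b \<Longrightarrow> {\<sigma> a, \<sigma> b} = {a, b}"
  shows "(\<exists>i\<in>K. \<forall>a\<in>K. \<sigma> a = i) \<or> (\<forall>a\<in>K. \<sigma> a = a)"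
proof (cases "\<exists>a\<in>K. \<exists>b\<in>K. \<sigma> a \<noteq> \<sigma> b")
  case True
  then obtain a b where ab: "a \<in> K" "b \<in> K" "\<sigma> a \<noteq> \<sigma> b" by blast
  \<comment> \<open>On \<open>a\<close> and \<open>b\<close> alone, \<open>\<sigma>\<close> could
    still be a swap. A third vertex \<open>c\<close> rules this out: if
    \<open>\<sigma> c \<noteq> \<sigma> a\<close>, then \<open>\<sigma> a\<close> lies in both
    \<open>{c, a}\<close> and \<open>{a, b}\<close>, so it is \<open>a\<close>; if
    \<open>\<sigma> c = \<sigma> a\<close>, then \<open>{c, b} = {a, b}\<close>, which is
    absurd.\<close>
  have fix3: "\<sigma> a = a \<and> \<sigma> b = b \<and> \<sigma> c = c" if "c \<in> K" "c \<noteq> a" "c \<noteq> b" for c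
  proof (cases "\<sigma> c = \<sigma> a")
    case True
    then have "{\<sigma> c, \<sigma> b} = {c, b}" using pres[of c b] ab that by simp
    then show ?thesis using pres[OF ab] ab that True by (metis doubleton_eq_iff)
  next
    case False
    then have "{\<sigma> c, \<sigma> a} = {c, a}" using pres[of c a] ab that by simp
    then show ?thesis using pres[OF ab] ab that by (metis doubleton_eq_iff)
  qed
  have "card (K - {a, b}) \<ge> 1" using diff_card_le_card_Diff[of "{a, b}" K] card_K
    by (auto simp: card_insert_if split: if_splits)
  then have "K - {a, b} \<noteq> {}" by force
  then show ?thesis using fix3 by blast
next
  case False
  moreover have "K \<noteq> {}" using card_K by auto
  ultimately show ?thesis using maps by blast
qed

section \<open>Part sizes, transversals and miscolored pairs\<close>

lemma k_bounds: "real k \<ge> 11" "real k ^ k > real k"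
proof -
  show "real k \<ge> 11" using card_K by simp
  moreover have "real k ^ 1 < real k ^ k" using card_K by (intro power_strict_increasing) auto
  ultimately show "real k ^ k > real k" by simp
qed

text \<open>A copy either gives every vertex its role under \<open>\<rho>\<close>, and is then an
  element of the product of the parts, or has a vertex in a wrong role. The second kind makes up at
  most a quarter of \<open>n ^ k / k ^ k\<close>.\<close>

lemma part_sizes_large:
  assumes V: "finite V" and dom: "\<And>v. v \<in> V \<Longrightarrow> dominant_role V v (\<rho> v)"
    and large: "real (card V) ^ k / real k ^ k \<le> real (card (Emb V))"
  shows "3 / 4 * (real (card V) ^ k / real k ^ k) \<le> (\<Prod>i\<in>K. real (card {v \<in> V. \<rho> v = i}))"
proof -
  define n where "n = card V"
  define P where "P = (\<Pi>\<^sub>E i\<in>K. {v \<in> V. \<rho> v = i})"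
  define X where "X v = {\<phi> \<in> Emb V. \<exists>a\<in>K - {\<rho> v}. \<phi> a = v}" for v
  have finP: "finite P" using V finite_K by (simp add: P_def finite_PiE)
  have finX: "finite (\<Union>v\<in>V. X v)" using V finite_Emb by (simp add: X_def)
  have "Emb V \<subseteq> P \<union> (\<Union>v\<in>V. X v)"
  proof
    fix \<phi> assume \<phi>: "\<phi> \<in> Emb V"
    show "\<phi> \<in> P \<union> (\<Union>v\<in>V. X v)"
    proof (cases "\<forall>a\<in>K. \<rho> (\<phi> a) = a")
      case True
      then show ?thesis using \<phi> by (auto simp: P_def Emb_def PiE_def)
    next
      case False
      then obtain a where "a \<in> K" "\<rho> (\<phi> a) \<noteq> a" by blast
      then have "\<phi> \<in> X (\<phi> a)" "\<phi> a \<in> V" using \<phi> EmbD(1)[OF \<phi>] by (auto simp: X_def)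
      then show ?thesis by blast
    qed
  qed
  then have "card (Emb V) \<le> card (P \<union> (\<Union>v\<in>V. X v))" using finP finX by (intro card_mono) auto
  also have "\<dots> \<le> card P + card (\<Union>v\<in>V. X v)" by (rule card_Un_le)
  also have "card (\<Union>v\<in>V. X v) \<le> (\<Sum>v\<in>V. card (X v))" using V by (rule card_UN_le)
  finally have "real (card (Emb V)) \<le> real (card P) + (\<Sum>v\<in>V. real (card (X v)))"
    by (simp flip: of_nat_sum)
  also have "(\<Sum>v\<in>V. real (card (X v))) \<le> (\<Sum>v\<in>V. real n ^ (k - 1) * (1 / (4 * real k ^ k)))"
  proof (rule sum_mono)
    fix v assume v: "v \<in> V"
    define N where "N = real (card V - 1)"
    have N: "0 \<le> N" "N \<le> real n" by (auto simp: N_def n_def)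
    have k1: "k - 1 = Suc (k - 2)" using card_K by simp
    have "real (card (X v)) \<le> N * (2 * N / (real k * (real k - 2))) ^ (k - 2)"
      unfolding X_def N_def by (rule card_wrong_role_le[OF V v dom[OF v]])
    also have "\<dots> = N ^ (k - 1) * (2 / (real k * (real k - 2))) ^ (k - 2)"
      unfolding k1 by (rule mult_power_scaled)
    also have "\<dots> \<le> real n ^ (k - 1) * (1 / (4 * real k ^ k))"
      using N wrong_role_bound[OF card_K] k_bounds
      by (intro mult_mono power_mono) (auto intro!: zero_le_power divide_nonneg_nonneg)
    finally show "real (card (X v)) \<le> real n ^ (k - 1) * (1 / (4 * real k ^ k))" .
  qed
  also have "\<dots> = real n * real n ^ (k - 1) * (1 / (4 * real k ^ k))" by (simp add: n_def)
  also have "real n * real n ^ (k - 1) = real n ^ k" using card_K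
    by (metis One_nat_def Suc_pred card_gt_0_iff finite_K power_Suc not_numeral_le_zero card.empty)
  finally have "real (card (Emb V)) \<le> real (card P) + real n ^ k * (1 / (4 * real k ^ k))" by simp
  moreover have "real (card P) = (\<Prod>i\<in>K. real (card {v \<in> V. \<rho> v = i}))"
    using finite_K by (simp add: P_def card_PiE)
  ultimately show ?thesis using large by (simp add: n_def)
qed

text \<open>Two disjoint parts satisfy \<open>p i * p j \<le> n\<^sup>2 / 4\<close>. Dividing the
  lower bound for the full product by this turns 3/4 into 3.\<close>

lemma prod_other_parts_large:
  assumes V: "finite V" and large: "3 / 4 * (real (card V) ^ k / real k ^ k) \<le> (\<Prod>i\<in>K. real (card {v \<in> V. \<rho> v = i}))"
    and ij: "i \<in> K" "j \<in> K" "i \<noteq> j" and V0: "V \<noteq> {}"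
  shows "3 / real k ^ k * real (card V) ^ (k - 2) \<le> (\<Prod>l\<in>K - {i, j}. real (card {v \<in> V. \<rho> v = l}))"
proof -
  define n where "n = real (card V)"
  define p where "p l = real (card {v \<in> V. \<rho> v = l})" for l
  define Q where "Q = (\<Prod>l\<in>K - {i, j}. p l)"
  have n: "n > 0" using V V0 by (simp add: n_def card_gt_0_iff)
  have Q: "0 \<le> Q" by (simp add: Q_def p_def prod_nonneg)
  have "k = 2 + (k - 2)" using card_K by simp
  then have k2: "n ^ k = n\<^sup>2 * n ^ (k - 2)" by (metis power_add)
  have "card {v \<in> V. \<rho> v = i} + card {v \<in> V. \<rho> v = j} = card ({v \<in> V. \<rho> v = i} \<union> {v \<in> V. \<rho> v = j})"
    using V ij by (intro card_Un_disjoint[symmetric]) auto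
  also have "\<dots> \<le> card V" using V by (intro card_mono) auto
  finally have "p i + p j \<le> n" by (simp add: p_def n_def)
  moreover have "p i \<ge> 0" "p j \<ge> 0" by (auto simp: p_def)
  ultimately have "(p i + p j)\<^sup>2 \<le> n\<^sup>2" by (intro power_mono) auto
  moreover have "0 \<le> (p i - p j)\<^sup>2" by simp
  ultimately have pp: "p i * p j \<le> n\<^sup>2 / 4" by (simp add: power2_eq_square algebra_simps)
  have "(\<Prod>l\<in>K. p l) = p i * (\<Prod>l\<in>K - {i}. p l)" using ij finite_K by (intro prod.remove) auto
  also have "(\<Prod>l\<in>K - {i}. p l) = p j * (\<Prod>l\<in>K - {i} - {j}. p l)" using ij finite_K by (intro prod.remove) auto
  also have "K - {i} - {j} = K - {i, j}" by auto
  finally have "(\<Prod>l\<in>K. p l) = p i * p j * Q" by (simp add: Q_def)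
  also have "\<dots> \<le> n\<^sup>2 / 4 * Q" using pp Q by (rule mult_right_mono)
  finally have "3 / 4 * (n ^ k / real k ^ k) \<le> n\<^sup>2 / 4 * Q" using large by (simp add: p_def n_def)
  then have "n\<^sup>2 * (3 / real k ^ k * n ^ (k - 2)) \<le> n\<^sup>2 * Q" unfolding k2 by (simp add: mult.left_commute)
  then have "3 / real k ^ k * n ^ (k - 2) \<le> Q" using n by (subst (asm) mult_le_cancel_left_pos) auto
  then show ?thesis by (simp add: Q_def n_def p_def)
qed

definition miscolored :: "'v set \<Rightarrow> ('v \<Rightarrow> 'a) \<Rightarrow> 'v set set" where
  "miscolored V \<rho> = {e \<in> nsets V 2. inj_on \<rho> e \<and> col e \<noteq> r (\<rho> ` e)}"

text \<open>Without a miscolored pair, injectivity of \<open>r\<close> makes the map from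
  \<open>a\<close> to \<open>\<rho> (\<phi> a)\<close> preserve every pair that it does not
  collapse. By \<open>const_or_id\<close> it is the identity, giving a transversal, or constant,
  giving a copy inside one part.\<close>

lemma Emb_cases:
  assumes maps: "\<And>v. v \<in> V \<Longrightarrow> \<rho> v \<in> K"
    and \<phi>: "\<phi> \<in> Emb V" and no: "\<And>e. e \<in> miscolored V \<rho> \<Longrightarrow> \<not> e \<subseteq> \<phi> ` K"
  shows "\<phi> \<in> (\<Pi>\<^sub>E i\<in>K. {v \<in> V. \<rho> v = i}) \<or> (\<exists>i\<in>K. \<phi> \<in> Emb {v \<in> V. \<rho> v = i})"
proof -
  have "{\<rho> (\<phi> a), \<rho> (\<phi> b)} = {a, b}" if ab: "a \<in> K" "b \<in> K" "\<rho> (\<phi> a) \<noteq> \<rho> (\<phi> b)" for a b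
  proof -
    have ne: "a \<noteq> b" "\<phi> a \<noteq> \<phi> b" using ab by auto
    have mem: "\<phi> a \<in> V" "\<phi> b \<in> V" using EmbD(1)[OF \<phi>] ab by auto
    have "{\<phi> a, \<phi> b} \<notin> miscolored V \<rho>" using no[of "{\<phi> a, \<phi> b}"] ab by auto
    then have "col {\<phi> a, \<phi> b} = r (\<rho> ` {\<phi> a, \<phi> b})"
      using mem ne ab by (simp add: miscolored_def)
    then have "r {a, b} = r {\<rho> (\<phi> a), \<rho> (\<phi> b)}" using EmbD(3)[OF \<phi> ab(1,2) ne(1)] by simp
    then show ?thesis using r_eq_iff[OF ab(1,2) ne(1)] maps mem ab by metis
  qed
  then consider i where "i \<in> K" "\<forall>a\<in>K. \<rho> (\<phi> a) = i" | "\<forall>a\<in>K. \<rho> (\<phi> a) = a"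
    using const_or_id[of "\<lambda>a. \<rho> (\<phi> a)"] maps EmbD(1)[OF \<phi>] by blast
  then show ?thesis
  proof cases
    case 1
    then have "\<phi> \<in> Emb {v \<in> V. \<rho> v = i}" using \<phi> by (auto simp: Emb_def PiE_def Pi_def)
    with 1 show ?thesis by blast
  next
    case 2
    then show ?thesis using \<phi> by (auto simp: Emb_def PiE_def)
  qed
qed

lemma card_transversals_through_pair_ge:
  fixes V :: "'v set" and \<rho> :: "'v \<Rightarrow> 'a"
  assumes V: "finite V" and maps: "\<And>v. v \<in> V \<Longrightarrow> \<rho> v \<in> K"
    and vw: "v \<in> V" "w \<in> V" "\<rho> v \<noteq> \<rho> w"
  shows "(\<Prod>l\<in>K - {\<rho> v, \<rho> w}. card {u \<in> V. \<rho> u = l})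
    \<le> card {\<psi> \<in> (\<Pi>\<^sub>E i\<in>K. {u \<in> V. \<rho> u = i}). {v, w} \<subseteq> \<psi> ` K}"
proof -
  define i j where "i = \<rho> v" and "j = \<rho> w"
  have ij: "i \<in> K" "j \<in> K" "i \<noteq> j" using vw maps by (auto simp: i_def j_def)
  define E where "E g = (g(i := v))(j := w)" for g :: "'a \<Rightarrow> 'v"
  define D where "D = (\<Pi>\<^sub>E l\<in>K - {i, j}. {u \<in> V. \<rho> u = l})"
  have "inj_on E D"
  proof (rule inj_onI, rule ext)
    fix g h x assume "g \<in> D" "h \<in> D" "E g = E h"
    then show "g x = h x"
      by (cases "x = i \<or> x = j") (auto simp: D_def PiE_def extensional_def E_def fun_eq_iff split: if_splits)
  qed
  moreover have "E g \<in> {\<psi> \<in> (\<Pi>\<^sub>E i\<in>K. {u \<in> V. \<rho> u = i}). {v, w} \<subseteq> \<psi> ` K}" if g: "g \<in> D" for g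
  proof -
    have "E g \<in> (\<Pi>\<^sub>E i\<in>K. {u \<in> V. \<rho> u = i})"
    proof (rule PiE_I)
      fix l assume "l \<in> K"
      then show "E g l \<in> {u \<in> V. \<rho> u = l}" using g vw ij by (auto simp: E_def D_def i_def j_def)
    next
      fix l assume "l \<notin> K"
      then show "E g l = undefined" using g ij by (auto simp: E_def D_def PiE_def extensional_def)
    qed
    moreover have "v = E g i" "w = E g j" using ij by (auto simp: E_def)
    ultimately show ?thesis using ij by auto
  qed
  moreover have "finite (\<Pi>\<^sub>E i\<in>K. {u \<in> V. \<rho> u = i})" using V finite_K by (simp add: finite_PiE)
  ultimately have "card D \<le> card {\<psi> \<in> (\<Pi>\<^sub>E i\<in>K. {u \<in> V. \<rho> u = i}). {v, w} \<subseteq> \<psi> ` K}"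
    by (intro card_inj_on_le[of E]) auto
  moreover have "card D = (\<Prod>l\<in>K - {i, j}. card {u \<in> V. \<rho> u = l})"
    using finite_K by (simp add: D_def card_PiE)
  ultimately show ?thesis by (simp add: i_def j_def)
qed

text \<open>A miscolored pair destroys every transversal through it, and these outnumber the copies through
  it by a factor of \<open>k choose 2\<close>, the number of pairs in a transversal.\<close>

lemma card_Emb_le_prod_plus_sum:
  assumes V: "finite V" "V \<noteq> {}" and dom: "\<And>v. v \<in> V \<Longrightarrow> dominant_role V v (\<rho> v)"
    and large: "real (card V) ^ k / real k ^ k \<le> real (card (Emb V))"
  shows "card (Emb V)
    \<le> (\<Prod>i\<in>K. card {v \<in> V. \<rho> v = i}) + (\<Sum>i\<in>K. card (Emb {v \<in> V. \<rho> v = i}))"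
proof -
  define W where "W i = {v \<in> V. \<rho> v = i}" for i
  define P where "P = (\<Pi>\<^sub>E i\<in>K. W i)"
  define Mis where "Mis = miscolored V \<rho>"
  define thr where "thr \<psi> = {e \<in> Mis. e \<subseteq> \<psi> ` K}" for \<psi> :: "'a \<Rightarrow> 'v"
  \<comment> \<open>\<open>P\<close> contains all transversals, whether or not they are copies. The
    copies will be covered by \<open>P - M\<close>, the copies inside the parts, and
    \<open>B\<close>, so that \<open>card B \<le> card M\<close> is enough.\<close>
  define M where "M = {\<psi> \<in> P. thr \<psi> \<noteq> {}}"
  define B where "B = (\<Union>e\<in>Mis. {\<phi> \<in> Emb V. e \<subseteq> \<phi> ` K})"
  define n where "n = real (card V)"
  have maps: "\<rho> v \<in> K" if "v \<in> V" for v using dom[OF that] by (simp add: dominant_role_def)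
  have finP: "finite P" using V finite_K by (simp add: P_def W_def finite_PiE)
  have finMis: "finite Mis" using V by (simp add: Mis_def miscolored_def finite_imp_finite_nsets)
  have finE: "finite (Emb U)" if "U \<subseteq> V" for U using finite_Emb finite_subset[OF that] V by blast
  have finB: "finite B" using finMis finE by (simp add: B_def)
  have finM: "finite M" using finP by (simp add: M_def)
  have C2: "real (k choose 2) = real k * (real k - 1) / 2"
    using card_K by (simp add: choose_two real_of_nat_div of_nat_diff)
  have thr_le: "card (thr \<psi>) \<le> k choose 2" for \<psi>
  proof -
    have "thr \<psi> \<subseteq> nsets (\<psi> ` K) 2" by (auto simp: thr_def Mis_def miscolored_def nsets_def)
    then have "card (thr \<psi>) \<le> card (nsets (\<psi> ` K) 2)"
      using finite_K by (intro card_mono) (auto simp: finite_imp_finite_nsets)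
    also have "\<dots> = card (\<psi> ` K) choose 2" using finite_K by (simp add: card_nsets)
    also have "\<dots> \<le> k choose 2" using card_image_le[OF finite_K] by (rule binomial_right_mono)
    finally show ?thesis .
  qed
  have each: "real (k choose 2) * real (card {\<phi> \<in> Emb V. e \<subseteq> \<phi> ` K}) \<le> real (card {\<psi> \<in> P. e \<subseteq> \<psi> ` K})"
    if e: "e \<in> Mis" for e
  proof -
    obtain v w where vw: "e = {v, w}" "v \<in> V" "w \<in> V" "\<rho> v \<noteq> \<rho> w"
      using e by (fastforce simp: Mis_def miscolored_def nsets_2_eq)
    define N where "N = real (card V - 1)"
    have N: "0 \<le> N" "N \<le> n" by (auto simp: N_def n_def)
    have k2: "k - 2 = Suc (k - 3)" using card_K by simp
    have "real (card {\<phi> \<in> Emb V. e \<subseteq> \<phi> ` K}) \<le> 2 * (N * (2 * N / (real k * (real k - 3))) ^ (k - 3))"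
      unfolding N_def using card_miscolored_pair_le[OF V(1) dom, of e] e by (auto simp: Mis_def miscolored_def)
    also have "N * (2 * N / (real k * (real k - 3))) ^ (k - 3) = N ^ (k - 2) * (2 / (real k * (real k - 3))) ^ (k - 3)"
      unfolding k2 by (rule mult_power_scaled)
    also have "2 * \<dots> \<le> 2 * (n ^ (k - 2) * (2 / (real k * (real k - 3))) ^ (k - 3))"
      using N k_bounds by (intro mult_left_mono mult_right_mono power_mono) (auto intro!: zero_le_power divide_nonneg_nonneg)
    finally have "real (k choose 2) * real (card {\<phi> \<in> Emb V. e \<subseteq> \<phi> ` K})
        \<le> real (k choose 2) * (2 * (n ^ (k - 2) * (2 / (real k * (real k - 3))) ^ (k - 3)))"
      by (rule mult_left_mono) simp
    \<comment> \<open>The factor 2 for the two orders of the roles cancels against the denominator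
      of \<open>k choose 2\<close>.\<close>
    also have "\<dots> = n ^ (k - 2) * (real k * (real k - 1) * (2 / (real k * (real k - 3))) ^ (k - 3))"
      unfolding C2 by simp
    also have "\<dots> \<le> n ^ (k - 2) * (3 / real k ^ k)"
      using pair_bound[OF card_K] by (rule mult_left_mono) (simp add: n_def)
    also have "\<dots> \<le> (\<Prod>l\<in>K - {\<rho> v, \<rho> w}. real (card {u \<in> V. \<rho> u = l}))"
      using prod_other_parts_large[OF V(1) part_sizes_large[OF V(1) dom large], of "\<rho> v" "\<rho> w"] maps vw V
      by (simp add: n_def mult.commute)
    also have "\<dots> \<le> real (card {\<psi> \<in> P. e \<subseteq> \<psi> ` K})"
      using card_transversals_through_pair_ge[OF V(1) maps vw(2-4)]
      by (simp add: P_def W_def vw(1) flip: of_nat_prod)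
    finally show ?thesis .
  qed
  \<comment> \<open>The incidences between miscolored pairs and transversals are counted in two
    ways: each pair contributes at least \<open>k choose 2\<close> times its number of copies, and
    each element of \<open>M\<close> contains at most \<open>k choose 2\<close> pairs.\<close>
  have "card B \<le> (\<Sum>e\<in>Mis. card {\<phi> \<in> Emb V. e \<subseteq> \<phi> ` K})" unfolding B_def using finMis by (rule card_UN_le)
  then have "real (k choose 2) * real (card B) \<le> real (k choose 2) * (\<Sum>e\<in>Mis. real (card {\<phi> \<in> Emb V. e \<subseteq> \<phi> ` K}))"
    by (intro mult_left_mono) (simp_all flip: of_nat_sum)
  also have "\<dots> = (\<Sum>e\<in>Mis. real (k choose 2) * real (card {\<phi> \<in> Emb V. e \<subseteq> \<phi> ` K}))" by (rule sum_distrib_left)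
  also have "\<dots> \<le> (\<Sum>e\<in>Mis. real (card {\<psi> \<in> P. e \<subseteq> \<psi> ` K}))" by (rule sum_mono) (rule each)
  also have "\<dots> = (\<Sum>e\<in>Mis. \<Sum>\<psi>\<in>{\<psi> \<in> P. e \<subseteq> \<psi> ` K}. 1)" by simp
  also have "\<dots> = (\<Sum>\<psi>\<in>P. \<Sum>e\<in>thr \<psi>. 1)" unfolding thr_def by (rule sum.swap_restrict[OF finMis finP])
  also have "\<dots> = (\<Sum>\<psi>\<in>P. real (card (thr \<psi>)))" by simp
  also have "\<dots> = (\<Sum>\<psi>\<in>M. real (card (thr \<psi>)))"
    using finP by (intro sum.mono_neutral_right) (auto simp: M_def)
  also have "\<dots> \<le> (\<Sum>\<psi>\<in>M. real (k choose 2))" using thr_le by (intro sum_mono) simp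
  also have "\<dots> = real (k choose 2) * real (card M)" by simp
  finally have "real (card B) \<le> real (card M)" using card_K C2 by (subst (asm) mult_le_cancel_left_pos) auto
  then have BM: "card B \<le> card M" by simp
  have "Emb V \<subseteq> (P - M) \<union> (\<Union>i\<in>K. Emb (W i)) \<union> B"
  proof
    fix \<phi> assume \<phi>: "\<phi> \<in> Emb V"
    show "\<phi> \<in> (P - M) \<union> (\<Union>i\<in>K. Emb (W i)) \<union> B"
    proof (cases "thr \<phi> = {}")
      case True
      then have no: "\<not> e \<subseteq> \<phi> ` K" if "e \<in> miscolored V \<rho>" for e
        using that unfolding thr_def Mis_def by blast
      have "\<phi> \<notin> M" using True by (simp add: M_def)
      moreover have "\<phi> \<in> P \<or> (\<exists>i\<in>K. \<phi> \<in> Emb (W i))"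
        unfolding P_def W_def by (rule Emb_cases[OF maps \<phi> no])
      ultimately show ?thesis by simp
    next
      case False
      then show ?thesis using \<phi> by (auto simp: B_def thr_def)
    qed
  qed
  moreover have "finite ((P - M) \<union> (\<Union>i\<in>K. Emb (W i)) \<union> B)"
    using finP finB finE finite_K by (auto simp: W_def)
  ultimately have "card (Emb V) \<le> card ((P - M) \<union> (\<Union>i\<in>K. Emb (W i)) \<union> B)" by (intro card_mono)
  also have "\<dots> \<le> card ((P - M) \<union> (\<Union>i\<in>K. Emb (W i))) + card B" by (rule card_Un_le)
  also have "card ((P - M) \<union> (\<Union>i\<in>K. Emb (W i))) \<le> card (P - M) + card (\<Union>i\<in>K. Emb (W i))" by (rule card_Un_le)
  also have "card (\<Union>i\<in>K. Emb (W i)) \<le> (\<Sum>i\<in>K. card (Emb (W i)))" using finite_K by (rule card_UN_le)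
  finally have "card (Emb V) \<le> card (P - M) + (\<Sum>i\<in>K. card (Emb (W i))) + card M" using BM by simp
  moreover have "card (P - M) + card M = card P"
    using finP finM by (metis (no_types, lifting) M_def card_Diff_subset card_mono le_add_diff_inverse2 mem_Collect_eq subsetI)
  moreover have "card P = (\<Prod>i\<in>K. card (W i))" using finite_K by (simp add: P_def card_PiE)
  ultimately show ?thesis by (simp add: W_def)
qed

section \<open>The induction for the upper bound\<close>

lemma ex_dominant_role_if_many_copies:
  assumes V: "finite V" "v \<in> V" "card V \<ge> 2"
    and many: "(real (card V - 1) / real k) ^ (k - 1) \<le> real (card {\<phi> \<in> Emb V. \<exists>a\<in>K. \<phi> a = v})"
  shows "\<exists>i. dominant_role V v i"
proof -
  have "{\<phi> \<in> Emb V. \<exists>a\<in>K. \<phi> a = v} = (\<Union>a\<in>K. {\<phi> \<in> Emb V. \<phi> a = v})" by auto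
  then have "card {\<phi> \<in> Emb V. \<exists>a\<in>K. \<phi> a = v} \<le> (\<Sum>a\<in>K. card {\<phi> \<in> Emb V. \<phi> a = v})"
    using card_UN_le[OF finite_K] by auto
  then have "real (card {\<phi> \<in> Emb V. \<exists>a\<in>K. \<phi> a = v}) \<le> (\<Sum>a\<in>K. real (card {\<phi> \<in> Emb V. \<phi> a = v}))"
    by (simp flip: of_nat_sum)
  also have "\<dots> \<le> (\<Sum>a\<in>K. \<Prod>b\<in>K - {a}. deg V v {a, b})"
    using card_Emb_at_le[OF V(1)] by (intro sum_mono) auto
  finally have "(real (card V - 1) / real k) ^ (k - 1) \<le> (\<Sum>a\<in>K. \<Prod>b\<in>K - {a}. deg V v {a, b})"
    using many by linarith
  then have "\<exists>i\<in>K. (\<Sum>e\<in>{e \<in> nsets K 2. i \<notin> e}. deg V v e) \<le> 2 * real (card V - 1) / real k"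
    using V card_K by (intro ex_dominant_role finite_K refl sum_deg_le) auto
  then show ?thesis by (auto simp: dominant_role_def)
qed

theorem card_Emb_le:
  assumes "finite V"
  shows "real (card (Emb V)) \<le> real (card V) ^ k / (real k ^ k - real k)"
  using assms
\<comment> \<open>Induction over proper subsets serves both the deletion of one vertex and the
  passage to the parts.\<close>
proof (induction V rule: finite_psubset_induct)
  case (psubset V)
  define n where "n = card V"
  define D where "D = real k ^ k - real k"
  have D: "D > 0" using k_bounds by (simp add: D_def)
  show ?case
  proof (rule ccontr)
    assume "\<not> ?thesis"
    then have big: "real n ^ k / D < real (card (Emb V))" by (simp add: n_def D_def)
    have "real n ^ k / real k ^ k \<le> real n ^ k / D"
      using D k_bounds by (intro divide_left_mono) (auto simp: D_def)
    with big have large: "real (card V) ^ k / real k ^ k \<le> real (card (Emb V))" by (simp add: n_def)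
    have "0 \<le> real n ^ k / D" using D by simp
    with big have "Emb V \<noteq> {}" by auto
    then obtain \<phi> where "\<phi> \<in> Emb V" by blast
    then have "inj_on \<phi> K" "\<phi> ` K \<subseteq> V" by (auto simp: Emb_def)
    then have "k \<le> n" unfolding n_def using psubset.hyps card_inj_on_le by blast
    then have n: "n \<ge> 2" using card_K by simp
    then have V0: "V \<noteq> {}" by (auto simp: n_def)
    have "\<exists>i. dominant_role V v i" if v: "v \<in> V" for v
    proof -
      define N where "N = real (card V - 1)"
      have nN: "real n = N + 1" using n by (simp add: n_def N_def of_nat_diff)
      \<comment> \<open>A copy that avoids \<open>v\<close> survives its deletion. The induction
        hypothesis for \<open>V - {v}\<close> therefore forces many copies through
        \<open>v\<close>.\<close>
      have "Emb V \<subseteq> Emb (V - {v}) \<union> {\<phi> \<in> Emb V. \<exists>a\<in>K. \<phi> a = v}"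
        by (auto simp: Emb_def PiE_def Pi_def)
      then have "card (Emb V) \<le> card (Emb (V - {v}) \<union> {\<phi> \<in> Emb V. \<exists>a\<in>K. \<phi> a = v})"
        using psubset.hyps finite_Emb by (intro card_mono) auto
      also have "\<dots> \<le> card (Emb (V - {v})) + card {\<phi> \<in> Emb V. \<exists>a\<in>K. \<phi> a = v}" by (rule card_Un_le)
      finally have "real (card (Emb V)) \<le> real (card (Emb (V - {v}))) + real (card {\<phi> \<in> Emb V. \<exists>a\<in>K. \<phi> a = v})"
        by simp
      also have "real (card (Emb (V - {v}))) \<le> N ^ k / D"
        using psubset.IH[of "V - {v}"] v psubset.hyps by (auto simp: D_def N_def)
      finally have "(real n ^ k - N ^ k) / D \<le> real (card {\<phi> \<in> Emb V. \<exists>a\<in>K. \<phi> a = v})"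
        using big by (simp add: diff_divide_distrib)
      \<comment> \<open>The left-hand side equals \<open>k * N ^ (k - 1) / k ^ k\<close>. Replacing
        \<open>k ^ k\<close> by the smaller \<open>D\<close> and using the first two binomial terms
        of \<open>(N + 1) ^ k\<close> gives the right-hand side.\<close>
      moreover have "(N / real k) ^ (k - 1) \<le> (real n ^ k - N ^ k) / D"
      proof -
        have N0: "N \<ge> 0" by (simp add: N_def)
        have k1: "k = Suc (k - 1)" using card_K by simp
        have "real k * N ^ (k - 1) \<le> real n ^ k - N ^ k"
          using power_plus_one_ge[OF N0, of "k - 1"] k1 by (simp add: nN)
        then have "real k * N ^ (k - 1) / D \<le> (real n ^ k - N ^ k) / D"
          using D by (intro divide_right_mono) auto
        moreover have "(N / real k) ^ (k - 1) = real k * N ^ (k - 1) / real k ^ k"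
        proof -
          have "real k ^ k = real k * real k ^ (k - 1)" using k1 by (metis power_Suc)
          then show ?thesis using k_bounds by (simp add: power_divide)
        qed
        moreover have "real k * N ^ (k - 1) / real k ^ k \<le> real k * N ^ (k - 1) / D"
          using D k_bounds N0 by (intro divide_left_mono) (auto simp: D_def)
        ultimately show ?thesis by linarith
      qed
      ultimately have "(real (card V - 1) / real k) ^ (k - 1) \<le> real (card {\<phi> \<in> Emb V. \<exists>a\<in>K. \<phi> a = v})"
        unfolding N_def by linarith
      then show ?thesis
        using psubset.hyps v n by (intro ex_dominant_role_if_many_copies) (auto simp: n_def)
    qed
    then obtain \<rho> where dom: "dominant_role V v (\<rho> v)" if "v \<in> V" for v by metis
    define W where "W i = {v \<in> V. \<rho> v = i}" for i
    have maps: "\<rho> v \<in> K" if "v \<in> V" for v using dom[OF that] by (simp add: dominant_role_def)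
    have "3 / 4 * (real n ^ k / real k ^ k) \<le> (\<Prod>i\<in>K. real (card (W i)))"
      using part_sizes_large[OF psubset.hyps dom large] by (simp add: n_def W_def)
    moreover have "0 < 3 / 4 * (real n ^ k / real k ^ k)" using n k_bounds by simp
    ultimately have "(\<Prod>i\<in>K. real (card (W i))) \<noteq> 0" by linarith
    \<comment> \<open>With no part empty, every part is a proper subset of \<open>V\<close>, so the
      induction hypothesis applies to it.\<close>
    then have ne: "W i \<noteq> {}" if "i \<in> K" for i using that finite_K by (auto simp: prod_zero_iff)
    have IH: "real (card (Emb (W i))) \<le> real (card (W i)) ^ k / D" if i: "i \<in> K" for i
    proof -
      have "\<exists>j\<in>K. j \<noteq> i" using card_K i
        by (metis card_1_singletonE card_eq_0_iff is_singletonI' is_singleton_altdef empty_iff not_numeral_le_zero numeral_le_one_iff semiring_norm(70))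
      then obtain j where "j \<in> K" "j \<noteq> i" by blast
      with ne[of j] have "W i \<subset> V" by (auto simp: W_def)
      then show ?thesis using psubset.IH by (simp add: D_def)
    qed
    have "card V = card (\<Union>i\<in>K. W i)" by (rule arg_cong[of _ _ card]) (use maps in \<open>auto simp: W_def\<close>)
    also have "\<dots> = (\<Sum>i\<in>K. card (W i))"
      using finite_K psubset.hyps by (intro card_UN_disjoint) (auto simp: W_def)
    finally have tot: "real n = (\<Sum>i\<in>K. real (card (W i)))" by (simp add: n_def)
    have "card (Emb V) \<le> (\<Prod>i\<in>K. card (W i)) + (\<Sum>i\<in>K. card (Emb (W i)))"
      unfolding W_def by (rule card_Emb_le_prod_plus_sum[OF psubset.hyps V0 dom large])
    then have "real (card (Emb V)) \<le> (\<Prod>i\<in>K. real (card (W i))) + (\<Sum>i\<in>K. real (card (Emb (W i))))"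
      by (simp flip: of_nat_sum of_nat_prod of_nat_add)
    also have "(\<Sum>i\<in>K. real (card (Emb (W i)))) \<le> (\<Sum>i\<in>K. real (card (W i)) ^ k / D)"
      by (intro sum_mono IH)
    also have "(\<Prod>i\<in>K. real (card (W i))) + (\<Sum>i\<in>K. real (card (W i)) ^ k / D)
        = (D * (\<Prod>i\<in>K. real (card (W i))) + (\<Sum>i\<in>K. real (card (W i)) ^ k)) / D"
      using D by (simp add: add_divide_distrib sum_divide_distrib)
    \<comment> \<open>This is \<open>prod_plus_sum_powers_le\<close> for the part sizes, whose sum
      is \<open>n\<close>; its coefficient \<open>k ^ k - k\<close> is exactly
      \<open>D\<close>.\<close>
    also have "\<dots> \<le> real n ^ k / D"
      unfolding D_def tot using D card_K finite_K
      by (intro divide_right_mono prod_plus_sum_powers_le) (auto simp: D_def)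
    finally show False using big by simp
  qed
qed

end

section \<open>Iterated blow-ups\<close>

lemma induced_induced [simp]: "induced (induced G U) S = induced G S"
  by (simp add: induced_def)

lemma verts_induced [simp]: "verts (induced G S) = S"
  and color_induced [simp]: "color (induced G S) = color G"
  by (simp_all add: induced_def)

lemma edges_induced_mono: "S \<subseteq> verts G \<Longrightarrow> edges (induced G S) \<subseteq> edges G"
  by (simp add: edges_def nsets_mono)

text \<open>Inverting the isomorphism from a copy \<open>S\<close> to \<open>R\<close> gives an
  embedding with image \<open>S\<close>, so there are at most as many copies as embeddings.\<close>

lemma copies_le_power:
  fixes R :: "('a, 't) cgraph" and G :: "('v, 't) cgraph"
  assumes R: "colored_complete T R" "num_verts R = k" "k \<ge> 11" "rainbow R"
    and G: "finite (verts G)"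
  shows "real (copies R G) \<le> real (num_verts G) ^ k / (real k ^ k - real k)"
proof -
  interpret rainbow_pattern "verts R" "color R" "color G"
    using R by unfold_locales (auto simp: colored_complete_def num_verts_def rainbow_def edges_def)
  have "{S \<in> nsets (verts G) (num_verts R). cgraph_iso (induced G S) R}
      \<subseteq> (\<lambda>\<phi>. \<phi> ` verts R) ` Emb (verts G)"
  proof
    fix S assume "S \<in> {S \<in> nsets (verts G) (num_verts R). cgraph_iso (induced G S) R}"
    then obtain f where S: "S \<subseteq> verts G" and f: "bij_betw f S (verts R)"
      and col: "\<And>e. e \<in> nsets S 2 \<Longrightarrow> color R (f ` e) = color G e"
      by (auto simp: cgraph_iso_def edges_def nsets_def)
    define \<phi> where "\<phi> = restrict (inv_into S f) (verts R)"
    have inv: "bij_betw (inv_into S f) (verts R) S" using f by (rule bij_betw_inv_into)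
    then have bij: "bij_betw \<phi> (verts R) S"
      by (rule bij_betw_cong[THEN iffD1, rotated]) (simp add: \<phi>_def)
    have "color G (\<phi> ` e) = color R e" if e: "e \<in> nsets (verts R) 2" for e
    proof -
      have sub: "e \<subseteq> verts R" using e by (auto simp: nsets_def)
      have "inj_on \<phi> e" using bij sub by (meson bij_betw_def inj_on_subset)
      then have "\<phi> ` e \<in> nsets S 2"
        using e bij sub by (auto simp: nsets_def card_image bij_betw_def)
      moreover have "f ` \<phi> ` e = e"
      proof -
        have "f (\<phi> a) = a" if "a \<in> e" for a
          using that sub f by (simp add: \<phi>_def bij_betw_inv_into_right subset_iff)
        then show ?thesis by (simp add: image_image)
      qed
      ultimately show ?thesis using col[of "\<phi> ` e"] by simp
    qed
    then have "\<phi> \<in> Emb (verts G)"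
      using bij S by (auto simp: Emb_def bij_betw_def \<phi>_def)
    moreover have "S = \<phi> ` verts R" using bij by (simp add: bij_betw_def)
    ultimately show "S \<in> (\<lambda>\<phi>. \<phi> ` verts R) ` Emb (verts G)" by blast
  qed
  then have "copies R G \<le> card (Emb (verts G))"
    unfolding copies_def using finite_Emb[OF G] by (rule surj_card_le[rotated])
  then have "real (copies R G) \<le> real (card (Emb (verts G)))" by simp
  also have "\<dots> \<le> real (card (verts G)) ^ card (verts R) / (real (card (verts R)) ^ card (verts R) - real (card (verts R)))"
    by (rule card_Emb_le[OF G])
  finally show ?thesis using R by (simp add: num_verts_def)
qed

section \<open>Lower bound for iterated blow-ups\<close>

lemma copies_blowup_ge:
  assumes F: "finite (verts F)" "card (verts F) \<ge> 2" and G: "finite (verts G)"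
    and V: "verts G = (\<Union>i\<in>verts F. V i)" and dis: "disjoint_family_on V (verts F)"
    and cross: "\<forall>i\<in>verts F. \<forall>j\<in>verts F. i \<noteq> j \<longrightarrow>
       (\<forall>v\<in>V i. \<forall>w\<in>V j. color G {v, w} = color F {i, j})"
  shows "(\<Prod>i\<in>verts F. card (V i)) + (\<Sum>i\<in>verts F. copies F (induced G (V i))) \<le> copies F G"
proof -
  define K where "K = verts F"
  define k where "k = card K"
  define P where "P = (\<Pi>\<^sub>E i\<in>K. V i)"
  define C where "C U = {S \<in> nsets U k. cgraph_iso (induced G S) F}" for U
  have finK: "finite K" and k2: "k \<ge> 2" using F by (auto simp: K_def k_def)
  have finV: "finite (V i)" if "i \<in> K" for i using G V that by (auto simp: K_def intro: finite_subset)
  have uniq: "i = j" if "i \<in> K" "j \<in> K" "v \<in> V i" "v \<in> V j" for i j v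
    using dis that by (auto simp: disjoint_family_on_def K_def)
  have inV: "\<psi> i \<in> V i" if "\<psi> \<in> P" "i \<in> K" for \<psi> i using that by (auto simp: P_def)
  have inj: "inj_on \<psi> K" if "\<psi> \<in> P" for \<psi>
    using uniq inV[OF that] by (metis inj_onI)
  have injP: "inj_on (\<lambda>\<psi>. \<psi> ` K) P"
  proof (rule inj_onI, rule ext)
    fix \<psi> \<chi> i assume *: "\<psi> \<in> P" "\<chi> \<in> P" "\<psi> ` K = \<chi> ` K"
    show "\<psi> i = \<chi> i"
    proof (cases "i \<in> K")
      case True
      then obtain j where j: "j \<in> K" "\<psi> i = \<chi> j" using * by blast
      then have "i = j" using uniq[of i j "\<psi> i"] inV * True by metis
      with j show ?thesis by simp
    next
      case False
      with * show ?thesis by (auto simp: P_def PiE_def extensional_def)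
    qed
  qed
  have finC: "finite (C U)" if "finite U" for U using that by (simp add: C_def finite_imp_finite_nsets)
  \<comment> \<open>The isomorphism to \<open>F\<close> sends each vertex of a transversal to the
    index of its part.\<close>
  have trans: "(\<lambda>\<psi>. \<psi> ` K) ` P \<subseteq> C (verts G)"
  proof (clarify)
    fix \<psi> assume \<psi>: "\<psi> \<in> P"
    define f where "f = inv_into K \<psi>"
    have bij: "bij_betw f (\<psi> ` K) K" unfolding f_def
      using inj[OF \<psi>] by (simp add: inj_on_imp_bij_betw bij_betw_inv_into)
    have f: "f (\<psi> i) = i" if "i \<in> K" for i using inj[OF \<psi>] that by (simp add: f_def)
    have "color F (f ` e) = color G e" if e: "e \<in> nsets (\<psi> ` K) 2" for e
    proof -
      obtain i j where ij: "i \<in> K" "j \<in> K" "i \<noteq> j" "e = {\<psi> i, \<psi> j}"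
        using e by (auto simp: nsets_2_eq)
      then show ?thesis using f cross inV[OF \<psi>] by (simp add: K_def)
    qed
    then have "cgraph_iso (induced G (\<psi> ` K)) F"
      using bij by (auto simp: cgraph_iso_def edges_def K_def)
    moreover have "\<psi> ` K \<subseteq> verts G" using inV[OF \<psi>] V by (auto simp: K_def)
    ultimately show "\<psi> ` K \<in> C (verts G)"
      using card_image[OF inj[OF \<psi>]] finK by (simp add: C_def nsets_def k_def)
  qed
  have inner: "(\<Union>i\<in>K. C (V i)) \<subseteq> C (verts G)"
    using V by (auto simp: C_def K_def nsets_def)
  have ne: "S \<noteq> {}" if "S \<in> C U" for S U using that k2 by (auto simp: C_def nsets_def)
  \<comment> \<open>A transversal meets at least two parts because \<open>k \<ge> 2\<close>, so it
    is never one of the copies inside a part.\<close>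
  have "(\<lambda>\<psi>. \<psi> ` K) ` P \<inter> (\<Union>i\<in>K. C (V i)) = {}"
  proof (rule ccontr)
    assume "\<not> ?thesis"
    then obtain \<psi> i where \<psi>: "\<psi> \<in> P" and i: "i \<in> K" "\<psi> ` K \<subseteq> V i" by (auto simp: C_def nsets_def)
    have "j = i" if "j \<in> K" for j using uniq[OF that i(1)] inV[OF \<psi> that] i(2) that by blast
    then have "K \<subseteq> {i}" by blast
    then have "card K \<le> 1" by (metis card.empty card_insert_disjoint card_mono empty_iff finite.emptyI finite_insert One_nat_def)
    with k2 show False by (simp add: k_def)
  qed
  moreover have "card (\<Union>i\<in>K. C (V i)) = (\<Sum>i\<in>K. card (C (V i)))"
  proof (intro card_UN_disjoint ballI impI)
    fix i j assume ij: "i \<in> K" "j \<in> K" "i \<noteq> j"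
    show "C (V i) \<inter> C (V j) = {}"
    proof (rule ccontr)
      assume "\<not> ?thesis"
      then obtain S where S: "S \<in> C (V i)" "S \<in> C (V j)" by blast
      obtain x where "x \<in> S" using ne[OF S(1)] by blast
      with S have "x \<in> V i" "x \<in> V j" by (auto simp: C_def nsets_def)
      with uniq ij show False by blast
    qed
  qed (use finK finC finV in auto)
  moreover have "card ((\<lambda>\<psi>. \<psi> ` K) ` P) = (\<Prod>i\<in>K. card (V i))"
    using finK by (simp add: card_image[OF injP]) (simp add: P_def card_PiE)
  moreover have "finite P" using finK finV by (auto simp: P_def intro!: finite_PiE)
  ultimately have "(\<Prod>i\<in>K. card (V i)) + (\<Sum>i\<in>K. card (C (V i))) = card ((\<lambda>\<psi>. \<psi> ` K) ` P \<union> (\<Union>i\<in>K. C (V i)))"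
    using finK finC finV by (subst card_Un_disjoint) auto
  also have "\<dots> \<le> card (C (verts G))" using trans inner finC[OF G] by (intro card_mono) auto
  finally show ?thesis by (simp add: copies_def C_def K_def k_def num_verts_def)
qed

text \<open>With \<open>n = k * x\<close>, the error terms \<open>2 * k * x ^ (k - 1)\<close> from
  unequal part sizes and \<open>k * (2 * x) ^ (k - 1)\<close> inherited from the parts together fit
  into \<open>n ^ (k - 1)\<close>, so the same form of error passes through the recursion.\<close>

lemma lower_order_bound:
  assumes "k \<ge> 11"
  shows "2 * real k + real k * 2 ^ (k - 1) \<le> real k ^ (k - 1)"
proof -
  define m where "m = k - 2"
  have k: "k = m + 2" and m: "m \<ge> 9" using assms by (auto simp: m_def)
  have "(2::real) ^ 2 \<le> 2 ^ m" using m by (intro power_increasing) auto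
  then have "2 ^ m * 4 \<le> 2 ^ m * (2::real) ^ m" by (intro mult_left_mono) auto
  also have "\<dots> = 4 ^ m" by (simp flip: power_mult_distrib)
  also have "\<dots> \<le> real k ^ m" using assms by (intro power_mono) auto
  finally have "2 ^ m * 4 \<le> real k ^ m" .
  moreover have "(2::real) ^ 1 \<le> 2 ^ (m + 1)" by (intro power_increasing) auto
  ultimately have "2 + 2 ^ (m + 1) \<le> real k ^ m" unfolding power_add power_one_right by linarith
  then have "real k * (2 + 2 ^ (m + 1)) \<le> real k * real k ^ m" by (rule mult_left_mono) simp
  then show ?thesis by (simp add: k algebra_simps)
qed

lemma twice_le_power_self:
  assumes "k \<ge> 11"
  shows "2 * real k \<le> real k ^ k"
proof -
  have "2 * real k \<le> real k * real k" using assms by simp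
  also have "\<dots> = real k ^ 2" by (simp add: power2_eq_square)
  also have "\<dots> \<le> real k ^ k" using assms by (intro power_increasing) auto
  finally show ?thesis .
qed

lemma copies_iterated_blowup_ge:
  assumes F: "finite (verts F)" "num_verts F = k" "k \<ge> 11"
    and "iterated_blowup T F G"
  shows "real (num_verts G) ^ k / (real k ^ k - real k) - real (num_verts G) ^ (k - 1) \<le> real (copies F G)"
  using assms(4)
proof (induction rule: iterated_blowup.induct)
  case (small G)
  define n where "n = real (num_verts G)"
  \<comment> \<open>Below \<open>k\<close> vertices the claimed lower bound is at most 0, because
    \<open>n < k \<le> k ^ k - k\<close>.\<close>
  have "n \<le> real k ^ k - real k" using small F twice_le_power_self[OF F(3)] by (simp add: n_def)
  moreover have D: "0 < real k ^ k - real k" using F(3) twice_le_power_self[OF F(3)] by linarith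
  ultimately have "n / (real k ^ k - real k) \<le> 1" by simp
  then have "n / (real k ^ k - real k) * n ^ (k - 1) \<le> 1 * n ^ (k - 1)"
    by (rule mult_right_mono) (simp add: n_def)
  moreover have "n ^ k = n * n ^ (k - 1)" using F by (metis power_eq_if not_numeral_le_zero)
  ultimately show ?case by (simp add: n_def)
next
  case (blowup G V)
  define K where "K = verts F"
  define n where "n = real (num_verts G)"
  define x where "x = n / real k"
  define D where "D = real k ^ k - real k"
  define p where "p i = real (card (V i))" for i
  have cardK: "card K = k" "finite K" using F by (simp_all add: K_def num_verts_def)
  have k0: "real k > 0" using F by simp
  have D: "D > 0" "D \<ge> real k" using k0 twice_le_power_self[OF F(3)] unfolding D_def by linarith+
  have nk: "n = real k * x" using k0 by (simp add: x_def)
  have x1: "x \<ge> 1" using blowup.hyps(2) F k0 by (simp add: x_def n_def)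
  have k1: "k = Suc (k - 1)" using F by simp
  have finG: "finite (verts G)" using blowup.hyps(1) by (simp add: colored_complete_def)
  then have finV: "finite (V i)" if "i \<in> K" for i
    using blowup.hyps(3) that by (auto simp: K_def intro: finite_subset)
  have "num_verts G = (\<Sum>i\<in>K. card (V i))"
    unfolding num_verts_def blowup.hyps(3) K_def[symmetric]
    using cardK finV blowup.hyps(4) by (intro card_UN_disjoint) (auto simp: disjoint_family_on_def K_def)
  then have tot: "n = (\<Sum>i\<in>K. p i)" by (simp add: n_def p_def)
  have diff: "p i \<le> p j + 1" if "i \<in> K" "j \<in> K" for i j
    using blowup.hyps(5) that unfolding K_def p_def by (smt (verit) of_int_le_iff of_int_of_nat_eq of_nat_1 of_nat_add of_nat_le_iff)
  have pge: "x - 1 \<le> p i" if "i \<in> K" for i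
  proof -
    have "n \<le> (\<Sum>j\<in>K. p i + 1)" unfolding tot using diff that by (intro sum_mono) auto
    then show ?thesis using k0 nk cardK by simp
  qed
  \<comment> \<open>The part sizes are at most \<open>x + 1\<close>; the cruder
    \<open>2 * x\<close>, valid because \<open>x \<ge> 1\<close>, keeps the error term homogeneous
    in \<open>x\<close>.\<close>
  have ple: "p i \<le> 2 * x" if "i \<in> K" for i
  proof -
    have "(\<Sum>j\<in>K. p i - 1) \<le> n" unfolding tot using diff[OF that] by (intro sum_mono) (simp add: algebra_simps)
    then have "p i - 1 \<le> x" using k0 nk cardK by simp
    then show ?thesis using x1 by simp
  qed
  have bern: "x ^ k - real k * x ^ (k - 1) \<le> (x - 1) ^ k"
  proof -
    have "1 + real k * (- (1 / x)) \<le> (1 + - (1 / x)) ^ k" using x1 by (intro Bernoulli_inequality) auto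
    then have "x ^ k * (1 - real k / x) \<le> x ^ k * (1 - 1 / x) ^ k" using x1 by (intro mult_left_mono) auto
    also have "\<dots> = (x - 1) ^ k" using x1 by (simp add: right_diff_distrib flip: power_mult_distrib)
    finally show ?thesis using x1 k1 power_Suc[of x "k - 1"] by (simp add: right_diff_distrib mult.commute)
  qed
  have "(\<Prod>i\<in>K. x - 1) \<le> (\<Prod>i\<in>K. p i)" using pge x1 by (intro prod_mono) auto
  then have prod: "(x - 1) ^ k \<le> (\<Prod>i\<in>K. p i)" using cardK by simp
  have each: "(x - 1) ^ k / D - (2 * x) ^ (k - 1) \<le> real (copies F (induced G (V i)))" if i: "i \<in> K" for i
  proof -
    have "p i ^ k / D - p i ^ (k - 1) \<le> real (copies F (induced G (V i)))"
      using blowup.IH i by (simp add: K_def p_def D_def num_verts_def)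
    moreover have "(x - 1) ^ k / D \<le> p i ^ k / D" using pge[OF i] x1 D by (intro divide_right_mono power_mono) auto
    moreover have "p i ^ (k - 1) \<le> (2 * x) ^ (k - 1)" using ple[OF i] by (intro power_mono) (auto simp: p_def)
    ultimately show ?thesis by linarith
  qed
  have "(\<Sum>i\<in>K. (x - 1) ^ k / D - (2 * x) ^ (k - 1)) \<le> (\<Sum>i\<in>K. real (copies F (induced G (V i))))"
    by (intro sum_mono each)
  then have sum: "real k * ((x - 1) ^ k / D - (2 * x) ^ (k - 1)) \<le> (\<Sum>i\<in>K. real (copies F (induced G (V i))))"
    using cardK by simp
  have "(\<Prod>i\<in>K. card (V i)) + (\<Sum>i\<in>K. copies F (induced G (V i))) \<le> copies F G"
    unfolding K_def using copies_blowup_ge[OF F(1) _ finG blowup.hyps(3,4,6)] F by (simp add: num_verts_def)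
  then have "(\<Prod>i\<in>K. p i) + (\<Sum>i\<in>K. real (copies F (induced G (V i)))) \<le> real (copies F G)"
    by (simp add: p_def flip: of_nat_sum of_nat_prod of_nat_add)
  with prod sum have main: "(x - 1) ^ k * (1 + real k / D) - real k * (2 * x) ^ (k - 1) \<le> real (copies F G)"
    by (simp add: algebra_simps)
  \<comment> \<open>The recursion asks for a constant \<open>1 / D\<close> with
    \<open>1 + k / D = k ^ k / D\<close>: one unit from the transversals and \<open>k\<close>
    smaller blow-ups. This is where \<open>k ^ k - k\<close> comes from.\<close>
  have c: "1 + real k / D = real k ^ k / D" using D by (simp add: D_def field_simps)
  have c2: "1 + real k / D \<le> 2" using D by simp
  have "n ^ k / D = x ^ k * (1 + real k / D)" unfolding c nk by (simp add: power_mult_distrib)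
  moreover have "(x ^ k - real k * x ^ (k - 1)) * (1 + real k / D) \<le> (x - 1) ^ k * (1 + real k / D)"
    using bern D by (intro mult_right_mono) auto
  moreover have "real k * x ^ (k - 1) * (1 + real k / D) \<le> real k * x ^ (k - 1) * 2"
    using c2 x1 by (intro mult_left_mono) auto
  moreover have "x ^ (k - 1) * (2 * real k + real k * 2 ^ (k - 1)) \<le> x ^ (k - 1) * real k ^ (k - 1)"
    using lower_order_bound[OF F(3)] x1 by (intro mult_left_mono) auto
  moreover have "n ^ (k - 1) = x ^ (k - 1) * real k ^ (k - 1)" by (simp add: nk power_mult_distrib)
  ultimately have "n ^ k / D - n ^ (k - 1) \<le> (x - 1) ^ k * (1 + real k / D) - real k * (2 * x) ^ (k - 1)"
    by (simp add: algebra_simps power_mult_distrib)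
  with main show ?case by (simp add: n_def D_def)
qed

section \<open>Existence of iterated blow-ups\<close>

lemma ex_equitable_map:
  assumes "finite W" "finite K" "K \<noteq> {}"
  shows "\<exists>f. (\<forall>w\<in>W. f w \<in> K) \<and> (\<forall>i\<in>K. \<forall>j\<in>K. card {w \<in> W. f w = i} \<le> card {w \<in> W. f w = j} + 1)"
  using assms(1)
proof (induction W rule: finite_induct)
  case empty
  then show ?case using assms(3) by auto
next
  case (insert x W)
  then obtain f where f: "\<And>w. w \<in> W \<Longrightarrow> f w \<in> K"
    and eq: "\<And>i j. i \<in> K \<Longrightarrow> j \<in> K \<Longrightarrow> card {w \<in> W. f w = i} \<le> card {w \<in> W. f w = j} + 1" by blast
  \<comment> \<open>Each new element goes into a smallest class, which preserves the
    balance.\<close>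
  obtain m where m: "m \<in> K" and min: "\<And>i. i \<in> K \<Longrightarrow> card {w \<in> W. f w = m} \<le> card {w \<in> W. f w = i}"
    using ex_min_if_finite[of "(\<lambda>i. card {w \<in> W. f w = i}) ` K"] assms(2,3) by (auto simp: not_less)
  define g where "g = f(x := m)"
  have g: "{w \<in> insert x W. g w = i} = (if i = m then insert x {w \<in> W. f w = i} else {w \<in> W. f w = i})" for i
    using insert.hyps by (auto simp: g_def)
  have "card {w \<in> insert x W. g w = i} = card {w \<in> W. f w = i} + (if i = m then 1 else 0)" for i
    unfolding g using insert.hyps by simp
  then have "\<forall>i\<in>K. \<forall>j\<in>K. card {w \<in> insert x W. g w = i} \<le> card {w \<in> insert x W. g w = j} + 1"
    using eq min m by (simp add: le_SucI)
  moreover have "\<forall>w\<in>insert x W. g w \<in> K" using f m by (auto simp: g_def)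
  ultimately show ?case by blast
qed

lemma colored_complete_cong:
  assumes "verts G' = verts G" "\<And>e. e \<in> edges G \<Longrightarrow> color G' e = color G e"
  shows "colored_complete T G' \<longleftrightarrow> colored_complete T G"
  using assms by (auto simp: colored_complete_def edges_def)

lemma iterated_blowup_colored_complete: "iterated_blowup T F G \<Longrightarrow> colored_complete T G"
  by (erule iterated_blowup.cases) auto

text \<open>Colors of sets that are not edges are arbitrary. A graph glued from blow-ups agrees with
  them only on edges, so it inherits the property by this lemma.\<close>

lemma iterated_blowup_cong:
  assumes "iterated_blowup T F G" "verts G' = verts G"
    and "\<And>e. e \<in> edges G \<Longrightarrow> color G' e = color G e"
  shows "iterated_blowup T F G'"
  using assms
proof (induction arbitrary: G' rule: iterated_blowup.induct)
  case (small G)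
  have "colored_complete T G'" using small colored_complete_cong[of G' G T] by blast
  then show ?case using small by (intro iterated_blowup.small) (simp_all add: num_verts_def)
next
  case (blowup G V)
  have cc: "colored_complete T G'" using blowup colored_complete_cong[of G' G T] by blast
  have IH: "\<forall>i\<in>verts F. iterated_blowup T F (induced G' (V i))"
  proof
    fix i assume i: "i \<in> verts F"
    have "V i \<subseteq> verts G" using blowup.hyps(3) i by auto
    then have "edges (induced G (V i)) \<subseteq> edges G" by (rule edges_induced_mono)
    moreover have "\<And>G'. verts G' = verts (induced G (V i)) \<Longrightarrow>
        (\<And>e. e \<in> edges (induced G (V i)) \<Longrightarrow> color G' e = color (induced G (V i)) e) \<Longrightarrow> iterated_blowup T F G'"
      using blowup.IH i by blast
    ultimately show "iterated_blowup T F (induced G' (V i))"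
      using blowup.prems(2) by (simp add: subset_iff)
  qed
  have cr: "color G' {v, w} = color F {i, j}"
    if "i \<in> verts F" "j \<in> verts F" "i \<noteq> j" "v \<in> V i" "w \<in> V j" for i j v w
  proof -
    have "v \<noteq> w" using that blowup.hyps(4) by (auto simp: disjoint_family_on_def)
    then have "{v, w} \<in> edges G" using that blowup.hyps(3) by (auto simp: edges_def)
    then show ?thesis using blowup.prems(2) blowup.hyps(6) that by simp
  qed
  show ?case
    using cc blowup.hyps(2-5) blowup.prems(1) IH cr
    by (intro iterated_blowup.blowup[where V = V]) (simp_all add: num_verts_def)
qed

text \<open>This makes the sets of copy numbers and densities nonempty for every \<open>n\<close>,
  as their maxima require.\<close>

lemma ex_iterated_blowup:
  fixes W :: "'v set"
  assumes F: "colored_complete T F" "num_verts F \<ge> 2" and W: "finite W"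
  shows "\<exists>G. verts G = W \<and> iterated_blowup T F G"
  using W
proof (induction "card W" arbitrary: W rule: less_induct)
  case less
  define K where "K = verts F"
  have finK: "finite K" and k2: "card K \<ge> 2" using F by (auto simp: K_def colored_complete_def num_verts_def)
  show ?case
  proof (cases "card W < num_verts F")
    case True
    \<comment> \<open>A small graph needs some color from \<open>T\<close>; the color of any edge of
      \<open>F\<close> will do.\<close>
    obtain a b where "a \<in> K" "b \<in> K" "a \<noteq> b"
      using k2 by (metis card_2_iff' obtain_subset_with_card_n subset_iff)
    then have "color F {a, b} \<in> T" using F by (auto simp: colored_complete_def edges_def K_def)
    then have "colored_complete T \<lparr>verts = W, color = \<lambda>_. color F {a, b}\<rparr>"
      using less.prems by (simp add: colored_complete_def)
    then have "iterated_blowup T F \<lparr>verts = W, color = \<lambda>_. color F {a, b}\<rparr>"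
      using True by (intro iterated_blowup.small) (auto simp: num_verts_def)
    then show ?thesis by (intro exI[of _ "\<lparr>verts = W, color = \<lambda>_. color F {a, b}\<rparr>"]) simp
  next
    case False
    have "K \<noteq> {}" using k2 by auto
    then obtain f where f: "\<And>w. w \<in> W \<Longrightarrow> f w \<in> K"
      and eq: "\<And>i j. i \<in> K \<Longrightarrow> j \<in> K \<Longrightarrow> card {w \<in> W. f w = i} \<le> card {w \<in> W. f w = j} + 1"
      using ex_equitable_map[OF less.prems finK] by blast
    define V where "V i = {w \<in> W. f w = i}" for i
    have "\<exists>G. verts G = V i \<and> iterated_blowup T F G" if i: "i \<in> K" for i
    proof (rule less.hyps)
      show "finite (V i)" using less.prems by (simp add: V_def)
      \<comment> \<open>If one part were all of \<open>W\<close>, another would be empty, and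
        balance would give \<open>card W \<le> 1\<close>.\<close>
      show "card (V i) < card W"
      proof (rule psubset_card_mono[OF less.prems], rule ccontr)
        assume "\<not> V i \<subset> W"
        then have all: "V i = W" by (auto simp: V_def)
        obtain j where j: "j \<in> K" "j \<noteq> i"
          using k2 i by (metis card_2_iff' obtain_subset_with_card_n subset_iff)
        then have "V j = {}" using all by (auto simp: V_def)
        then have "card W \<le> 1" using eq[OF i j(1)] all by (simp flip: V_def)
        then show False using False F by simp
      qed
    qed
    then obtain H where H: "\<And>i. i \<in> K \<Longrightarrow> verts (H i) = V i" "\<And>i. i \<in> K \<Longrightarrow> iterated_blowup T F (H i)"
      by metis
    define G where "G = \<lparr>verts = W, color = \<lambda>e. if is_singleton (f ` e) then color (H (the_elem (f ` e))) e else color F (f ` e)\<rparr>"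
    have inside: "color G e = color (H i) e" if "i \<in> K" "e \<in> nsets (V i) 2" for i e
    proof -
      have "e \<noteq> {}" using that by (auto simp: nsets_def)
      then have "f ` e = {i}" using that by (auto simp: nsets_def V_def)
      then show ?thesis by (simp add: G_def)
    qed
    have cross: "color G {v, w} = color F {i, j}" if "i \<noteq> j" "v \<in> V i" "w \<in> V j" for i j v w
      using that by (auto simp: G_def V_def is_singleton_def)
    have cc: "colored_complete T (H i)" if "i \<in> K" for i
      using H(2)[OF that] by (rule iterated_blowup_colored_complete)
    have "color G e \<in> T" if e: "e \<in> edges G" for e
    proof -
      obtain v w where vw: "e = {v, w}" "v \<in> W" "w \<in> W" "v \<noteq> w"
        using e by (auto simp: edges_def G_def nsets_2_eq)
      show ?thesis
      proof (cases "f v = f w")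
        case True
        then have e: "e \<in> nsets (V (f v)) 2" using vw by (simp add: V_def)
        have "e \<in> edges (H (f v))" using e H(1)[OF f[OF vw(2)]] by (simp add: edges_def)
        then show ?thesis using inside[OF f[OF vw(2)] e] cc[OF f[OF vw(2)]]
          by (auto simp: colored_complete_def)
      next
        case False
        then have "color G e = color F {f v, f w}" using cross vw by (simp add: V_def)
        moreover have "{f v, f w} \<in> edges F" using False f vw by (simp add: edges_def K_def)
        ultimately show ?thesis using F(1) by (simp add: colored_complete_def)
      qed
    qed
    then have G: "colored_complete T G" using less.prems by (simp add: colored_complete_def G_def)
    have "iterated_blowup T F G"
    proof (rule iterated_blowup.blowup[where V = V])
      show "colored_complete T G" by (rule G)
      show "num_verts F \<le> num_verts G" using False by (simp add: num_verts_def G_def)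
      show "verts G = (\<Union>i\<in>verts F. V i)" using f by (auto simp: G_def V_def K_def)
      show "disjoint_family_on V (verts F)" by (auto simp: disjoint_family_on_def V_def)
      show "\<forall>i\<in>verts F. \<forall>j\<in>verts F. \<bar>int (card (V i)) - int (card (V j))\<bar> \<le> 1"
      proof (intro ballI)
        fix i j assume "i \<in> verts F" "j \<in> verts F"
        then show "\<bar>int (card (V i)) - int (card (V j))\<bar> \<le> 1"
          using eq[of i j] eq[of j i] by (simp add: K_def V_def)
      qed
      show "\<forall>i\<in>verts F. iterated_blowup T F (induced G (V i))"
      proof
        fix i assume "i \<in> verts F"
        then have i: "i \<in> K" by (simp add: K_def)
        show "iterated_blowup T F (induced G (V i))"
        proof (rule iterated_blowup_cong[OF H(2)[OF i]])
          show "verts (induced G (V i)) = verts (H i)" by (simp add: H(1)[OF i])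
          show "color (induced G (V i)) e = color (H i) e" if "e \<in> edges (H i)" for e
            using inside[OF i] that by (simp add: edges_def H(1)[OF i])
        qed
      qed
      show "\<forall>i\<in>verts F. \<forall>j\<in>verts F. i \<noteq> j \<longrightarrow> (\<forall>v\<in>V i. \<forall>w\<in>V j. color G {v, w} = color F {i, j})"
        using cross by blast
    qed
    then show ?thesis by (intro exI[of _ G]) (simp add: G_def)
  qed
qed

section \<open>Limits of the densities\<close>

lemma power_div_binomial_tendsto: "(\<lambda>n. real n ^ k / real (n choose k)) \<longlonglongrightarrow> fact k"
proof -
  have "(\<lambda>n. \<Prod>i=0..<k. 1 - real i / real n) \<longlonglongrightarrow> (\<Prod>i=0..<k. 1 - 0)"
    by (intro tendsto_prod tendsto_diff tendsto_const lim_const_over_n)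
  then have "(\<lambda>n. fact k / (\<Prod>i=0..<k. 1 - real i / real n)) \<longlonglongrightarrow> fact k / 1"
    by (intro tendsto_divide tendsto_const) auto
  \<comment> \<open>This holds already for \<open>0 < n < k\<close>, where a factor of the product
    and the binomial coefficient vanish and both quotients are 0.\<close>
  moreover have "\<forall>\<^sub>F n in sequentially. fact k / (\<Prod>i=0..<k. 1 - real i / real n) = real n ^ k / real (n choose k)"
    using eventually_gt_at_top[of 0]
  proof eventually_elim
    case (elim n)
    have "(\<Prod>i=0..<k. 1 - real i / real n) = (\<Prod>i=0..<k. (real n - real i) / real n)"
      using elim by (intro prod.cong) (auto simp: field_simps)
    also have "\<dots> = (\<Prod>i=0..<k. real n - real i) / real n ^ k" by (simp add: prod_dividef)
    also have "(\<Prod>i=0..<k. real n - real i) = fact k * real (n choose k)"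
      by (simp add: binomial_gbinomial gbinomial_mult_fact)
    finally show ?case by simp
  qed
  ultimately show ?thesis by (simp add: tendsto_cong)
qed

lemma copies_le_binomial: "finite (verts G) \<Longrightarrow> copies F G \<le> num_verts G choose num_verts F"
  unfolding copies_def num_verts_def card_nsets[symmetric]
  by (intro card_mono) (auto simp: finite_imp_finite_nsets)

theorem theorem1p2:
  fixes T :: "'t set" and R :: "('a, 't) cgraph" and k :: nat
  assumes "k \<ge> 11"
    and "colored_complete T R"
    and "num_verts R = k"
    and "rainbow R"
  shows "fractalizer T R \<and> inducibility T R = fact k / (real k ^ k - real k)"
proof -
  define D where "D = real k ^ k - real k"
  define U where "U n = real n ^ k / D" for n
  define L where "L n = real n ^ k / D - real n ^ (k - 1)" for n
  define b where "b n = real (n choose k)" for n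
  define X where "X n = {copies R G |G :: (nat, 't) cgraph. colored_complete T G \<and> num_verts G = n}" for n
  define Y where "Y n = {copy_density R G |G :: (nat, 't) cgraph. iterated_blowup T R G \<and> num_verts G = n}" for n
  have finR: "finite (verts R)" using assms(2) by (simp add: colored_complete_def)
  have upper: "real (copies R G) \<le> U n" if "colored_complete T G" "num_verts G = n"
    for G :: "(nat, 't) cgraph" and n
    using copies_le_power[OF assms(2,3,1,4), of G] that by (simp add: U_def D_def colored_complete_def)
  have lower: "L n \<le> real (copies R G)" if "iterated_blowup T R G" "num_verts G = n"
    for G :: "(nat, 't) cgraph" and n
    using copies_iterated_blowup_ge[OF finR assms(3,1) that(1)] that(2) by (simp add: L_def D_def)
  have ex: "\<exists>G :: (nat, 't) cgraph. iterated_blowup T R G \<and> num_verts G = n" for n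
    using ex_iterated_blowup[OF assms(2), of "{..<n}"] assms(1,3) by (auto simp: num_verts_def)
  \<comment> \<open>Iterated blow-ups are among the competitors for \<open>X\<close>, so their lower
    bound carries over; the same \<open>L\<close> and \<open>U\<close> enclose both maxima.\<close>
  have X: "L n \<le> real (Max (X n))" "real (Max (X n)) \<le> U n" for n
  proof -
    \<comment> \<open>\<open>T\<close> may be infinite, so finiteness comes from the bound on the
      values and not from the number of colorings.\<close>
    have "X n \<subseteq> {..n choose k}"
      using assms(3) copies_le_binomial by (auto simp: X_def colored_complete_def)
    then have fin: "finite (X n)" by (rule finite_subset) simp
    obtain G :: "(nat, 't) cgraph" where G: "iterated_blowup T R G" "num_verts G = n" using ex by blast
    then have mem: "copies R G \<in> X n" using iterated_blowup_colored_complete by (auto simp: X_def)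
    then have "Max (X n) \<in> X n" using fin by (intro Max_in) auto
    then show "real (Max (X n)) \<le> U n" using upper by (auto simp: X_def)
    have "copies R G \<le> Max (X n)" using fin mem by (rule Max_ge)
    then show "L n \<le> real (Max (X n))" using lower[OF G] by linarith
  qed
  have Y: "L n / b n \<le> Max (Y n) \<and> Max (Y n) \<le> U n / b n" for n
  proof -
    have "Y n \<subseteq> (\<lambda>m. real m / b n) ` {..n choose k}"
      using assms(3) copies_le_binomial iterated_blowup_colored_complete
      by (fastforce simp: Y_def b_def copy_density_def colored_complete_def)
    then have fin: "finite (Y n)" by (rule finite_subset) simp
    have "Y n \<noteq> {}" using ex by (auto simp: Y_def)
    then have "Max (Y n) \<in> Y n" using fin by (intro Max_in)
    then obtain G :: "(nat, 't) cgraph" where G: "Max (Y n) = copy_density R G"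
      "iterated_blowup T R G" "num_verts G = n" by (auto simp: Y_def)
    have "Max (Y n) = real (copies R G) / b n" using G assms(3) by (simp add: copy_density_def b_def)
    then show ?thesis
      using lower[OF G(2,3)] upper[OF iterated_blowup_colored_complete[OF G(2)] G(3)]
      by (simp add: divide_right_mono b_def)
  qed
  have "D \<noteq> 0" using assms(1) twice_le_power_self[OF assms(1)] unfolding D_def by linarith
  then have limU: "(\<lambda>n. U n / b n) \<longlonglongrightarrow> fact k / D"
    using tendsto_divide[OF power_div_binomial_tendsto[of k] tendsto_const[of D]]
    by (simp add: U_def b_def mult.commute)
  \<comment> \<open>The gap \<open>n ^ (k - 1)\<close> between \<open>U\<close> and \<open>L\<close>
    has one power of \<open>n\<close> less than \<open>b n\<close>, so it disappears in the
    limit.\<close>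
  have "(\<lambda>n. real n ^ k / b n * (1 / real n)) \<longlonglongrightarrow> fact k * 0"
    unfolding b_def by (intro tendsto_mult power_div_binomial_tendsto lim_1_over_n)
  moreover have "\<forall>\<^sub>F n in sequentially. real n ^ k / b n * (1 / real n) = real n ^ (k - 1) / b n"
    using eventually_gt_at_top[of 0]
  proof eventually_elim
    case (elim n)
    have "real n ^ k = real n * real n ^ (k - 1)" using assms(1) by (metis power_eq_if not_numeral_le_zero)
    then show ?case using elim by simp
  qed
  ultimately have "(\<lambda>n. real n ^ (k - 1) / b n) \<longlonglongrightarrow> 0" by (simp add: tendsto_cong)
  from tendsto_diff[OF limU this] have limL: "(\<lambda>n. L n / b n) \<longlonglongrightarrow> fact k / D"
    by (simp add: L_def U_def diff_divide_distrib)
  have "ind_n T R = (\<lambda>n. real (Max (X n)) / b n)"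
    using assms(3) by (simp add: fun_eq_iff ind_n_def max_copies_def X_def b_def)
  moreover have "(\<lambda>n. real (Max (X n)) / b n) \<longlonglongrightarrow> fact k / D"
    using X by (intro tendsto_sandwich[OF _ _ limL limU] always_eventually allI divide_right_mono)
      (auto simp: b_def)
  ultimately have ind: "inducibility T R = fact k / D" by (simp add: inducibility_def limI)
  have "(\<lambda>n. Max (Y n)) \<longlonglongrightarrow> fact k / D"
    using Y by (intro tendsto_sandwich[OF _ _ limL limU] always_eventually allI) auto
  then have "fractalizer T R" by (simp add: fractalizer_def ind Y_def)
  with ind show ?thesis by (simp add: D_def)
qed

end
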